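(* Let $A=(\mathbf a_0,\ldots,\mathbf a_n)$ be an integer $d\times(n+1)$ matrix with $d\le n+1$ and $\mathbb ZA=\mathbb Z^d$, let $\beta\in\mathbb C^d$, and let $t\in\{0,\ldots,n\}$. Let $b(\tilde s)$ be the $b$-function of $\mathcal F^{-1}(M_A(\beta))$ along $y_t=0$, expressed in the argument $\tilde s=\tilde\theta_t=-\delta_ty_t$; that is, $b$ is the monic polynomial of minimal degree with $b(-\delta_ty_t)\in \mathcal F^{-1}(H_A(\beta))+V^1\tilde D_A$. If $\varepsilon\in\mathbb C$ is a root of $b(\tilde s)$, then $\varepsilon\cdot\mathbf a_t$ is a point of intersection of the line $\mathbb C\cdot\mathbf a_t$ with the set $\beta-\operatorname{qdeg}_A(N)=\{\beta-q\mid q\in\operatorname{qdeg}_A(N)\}$, where $N=S_A/\partial_tS_A$.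
   Context: $R_A=\mathbb C[\partial_0,\ldots,\partial_n]$; $D_A$ is the Weyl algebra $\mathbb C[x_0,\ldots,x_n]\langle\partial_0,\ldots,\partial_n\rangle$ with $\partial_j=\partial/\partial x_j$. The toric ideal $I_A\subseteq R_A$ is generated by all $\partial^{\mathbf v_+}-\partial^{\mathbf v_-}$ with $\mathbf v\in\mathbb Z^{n+1}$, $A\mathbf v=0$, where $(\mathbf v_+)_j=\max(0,v_j)$, $(\mathbf v_-)_j=\max(0,-v_j)$; $S_A=R_A/I_A\cong\mathbb C[\mathbb NA]$. The hypergeometric left ideal $H_A(\beta)\subseteq D_A$ is generated by $I_A$ and the operators $E_i-\beta_i$, $E_i=\sum_{j=0}^na_{i,j}x_j\partial_j$, $1\le i\le d$, and $M_A(\beta)=D_A/H_A(\beta)$. Grading: $\deg_A(\partial_j)=\mathbf a_j$. For a $\mathbb Z^d$-graded $R_A$-module $N$, $\deg_A(N)\subseteq\mathbb Z^d$ is the set of degrees of nonzero homogeneous elements, and $\operatorname{qdeg}_A(N)$ (the quasi-degrees) is the Zariski closure of $\deg_A(N)$ in $\mathbb C^d$. Fourier transform: $\tilde D_A$ is the Weyl algebra $\mathbb C[y_0,\ldots,y_n]\langle\delta_0,\ldots,\delta_n\rangle$, $\delta_j=\partial/\partial y_j$, and $\mathcal F^{-1}:D_A\to\tilde D_A$ is the ring isomorphism with $\mathcal F^{-1}(\partial_j)=y_j$, $\mathcal F^{-1}(x_j)=-\delta_j$. Then $\mathcal F^{-1}(M_A(\beta))=\tilde D_A/\mathcal F^{-1}(H_A(\beta))$,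 and $\tilde\theta_j=\mathcal F^{-1}(x_j\partial_j)=-\delta_jy_j$. The $V$-filtration along $y_t$: $V^i\tilde D_A$ is the $\mathbb C$-span of the monomials $\delta^{\mu}y^{\nu}$ with $\nu_t-\mu_t\ge i$. *)

theory Defs
  imports "HOL-Analysis.Analysis" "HOL-Library.Poly_Mapping" "HOL-Library.Set_Algebras"
    "HOL-Computational_Algebra.Polynomial"
begin

section \<open>Polynomials in several variables\<close>

text \<open>The index set \<open>{0,\<dots>,n}\<close> is a finite type \<open>'n\<close> and \<open>{1,\<dots>,d}\<close> a finite type \<open>'d\<close>. A
  polynomial ring over the complex numbers with variables indexed by \<open>'n\<close> is the type
  \<open>'n mpoly\<close>: finitely supported functions from exponent vectors to coefficients.\<close>

type_synonym 'n expo = "'n \<Rightarrow>\<^sub>0 nat"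
type_synonym 'n mpoly = "'n expo \<Rightarrow>\<^sub>0 complex"

definition mvar :: "'n \<Rightarrow> 'n mpoly" where
  "mvar j = Poly_Mapping.single (Poly_Mapping.single j 1) 1"

definition mpartial :: "'n \<Rightarrow> 'n mpoly \<Rightarrow> 'n mpoly" where
  "mpartial j p = (\<Sum>m\<in>Poly_Mapping.keys p.
     Poly_Mapping.single (m - Poly_Mapping.single j 1)
       (of_nat (Poly_Mapping.lookup m j) * Poly_Mapping.lookup p m))"

definition mpoly_eval :: "'d::finite mpoly \<Rightarrow> complex ^ 'd \<Rightarrow> complex" where
  "mpoly_eval f z = (\<Sum>m\<in>Poly_Mapping.keys f.
     Poly_Mapping.lookup f m * (\<Prod>i\<in>UNIV. (z $ i) ^ Poly_Mapping.lookup m i))"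

definition zariski_closed :: "(complex ^ 'd::finite) set \<Rightarrow> bool" where
  "zariski_closed Z \<longleftrightarrow> (\<exists>F. Z = {z. \<forall>f\<in>F. mpoly_eval f z = 0})"

definition zariski_closure :: "(complex ^ 'd::finite) set \<Rightarrow> (complex ^ 'd) set" where
  "zariski_closure S = zariski_closed hull S"

text \<open>In a commutative ring this is the usual notion of an ideal.\<close>

definition left_ideal :: "'a::ring_1 set \<Rightarrow> bool" where
  "left_ideal I \<longleftrightarrow> 0 \<in> I \<and> (\<forall>a\<in>I. \<forall>b\<in>I. a + b \<in> I) \<and> (\<forall>r. \<forall>a\<in>I. r * a \<in> I)"


section \<open>The Weyl algebra\<close>

text \<open>The Weyl algebra is the algebra of operators on the polynomial ring generated by the scalars,
  the multiplications by the variables and the partial derivatives.\<close>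

inductive_set weyl_ops :: "('n mpoly \<Rightarrow> 'n mpoly) set" where
  scalar: "(\<lambda>p. Poly_Mapping.single 0 c * p) \<in> weyl_ops"
| var: "(\<lambda>p. mvar j * p) \<in> weyl_ops"
| partial: "mpartial j \<in> weyl_ops"
| add: "L \<in> weyl_ops \<Longrightarrow> M \<in> weyl_ops \<Longrightarrow> (\<lambda>p. L p + M p) \<in> weyl_ops"
| comp: "L \<in> weyl_ops \<Longrightarrow> M \<in> weyl_ops \<Longrightarrow> (\<lambda>p. L (M p)) \<in> weyl_ops"

lemma mpartial_superset:
  assumes "finite S" "Poly_Mapping.keys p \<subseteq> S"
  shows "mpartial j p = (\<Sum>m\<in>S. Poly_Mapping.single (m - Poly_Mapping.single j 1)
       (of_nat (Poly_Mapping.lookup m j) * Poly_Mapping.lookup p m))"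
  unfolding mpartial_def
  by (rule sum.mono_neutral_left) (use assms in \<open>auto simp: in_keys_iff\<close>)

lemma mpartial_add: "mpartial j (p + q) = mpartial j p + mpartial j q"
proof -
  let ?S = "Poly_Mapping.keys p \<union> Poly_Mapping.keys q"
  have "Poly_Mapping.keys (p + q) \<subseteq> ?S" by (rule Poly_Mapping.keys_add)
  then show ?thesis
    by (simp add: mpartial_superset[of ?S] lookup_add distrib_left single_add sum.distrib)
qed

lemma mpartial_zero [simp]: "mpartial j 0 = 0"
  by (simp add: mpartial_def)

lemma mpartial_monom:
  "mpartial j (Poly_Mapping.single m c) =
    Poly_Mapping.single (m - Poly_Mapping.single j 1) (of_nat (Poly_Mapping.lookup m j) * c)"
  by (subst mpartial_superset[of "{m}"]) auto

lemma weyl_ops_add: "L \<in> weyl_ops \<Longrightarrow> L (p + q) = L p + L q"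
  by (induction arbitrary: p q rule: weyl_ops.induct)
    (auto simp: distrib_left mpartial_add add_ac)

lemma weyl_ops_zero: "L \<in> weyl_ops \<Longrightarrow> L 0 = 0"
  by (metis weyl_ops_add add_cancel_right_left)

typedef 'n weyl = "weyl_ops :: ('n mpoly \<Rightarrow> 'n mpoly) set"
  morphisms weyl_apply Abs_weyl
  by (rule exI, rule weyl_ops.scalar)

setup_lifting type_definition_weyl

lift_definition weyl_const :: "complex \<Rightarrow> 'n weyl" is "\<lambda>c p. Poly_Mapping.single 0 c * p"
  by (rule weyl_ops.scalar)

lift_definition weyl_x :: "'n \<Rightarrow> 'n weyl" is "\<lambda>j p. mvar j * p"
  by (rule weyl_ops.var)

lift_definition weyl_d :: "'n \<Rightarrow> 'n weyl" is "mpartial"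
  by (rule weyl_ops.partial)

lemma weyl_ops_uminus: "L \<in> weyl_ops \<Longrightarrow> (\<lambda>p. - L p) \<in> weyl_ops"
proof -
  assume L: "L \<in> weyl_ops"
  have "(\<lambda>p. Poly_Mapping.single 0 (-1) * L p) \<in> weyl_ops"
    by (rule weyl_ops.comp[OF weyl_ops.scalar L])
  then show ?thesis by (simp add: single_uminus)
qed

instantiation weyl :: (type) ring_1
begin

lift_definition zero_weyl :: "'a weyl" is "\<lambda>p. 0"
proof -
  have "(\<lambda>p :: 'a mpoly. Poly_Mapping.single 0 0 * p) = (\<lambda>p. 0)" by (rule ext) simp
  then show "(\<lambda>p :: 'a mpoly. 0) \<in> weyl_ops" using weyl_ops.scalar[of 0] by metis
qed
lift_definition one_weyl :: "'a weyl" is "\<lambda>p. p"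
proof -
  have "(\<lambda>p :: 'a mpoly. Poly_Mapping.single 0 1 * p) = (\<lambda>p. p)" by (rule ext) simp
  then show "(\<lambda>p :: 'a mpoly. p) \<in> weyl_ops" using weyl_ops.scalar[of 1] by metis
qed
lift_definition plus_weyl :: "'a weyl \<Rightarrow> 'a weyl \<Rightarrow> 'a weyl" is "\<lambda>L M p. L p + M p"
  by (rule weyl_ops.add)
lift_definition uminus_weyl :: "'a weyl \<Rightarrow> 'a weyl" is "\<lambda>L p. - L p"
  by (rule weyl_ops_uminus)
lift_definition minus_weyl :: "'a weyl \<Rightarrow> 'a weyl \<Rightarrow> 'a weyl" is "\<lambda>L M p. L p - M p"
  using weyl_ops.add weyl_ops_uminus by fastforce
lift_definition times_weyl :: "'a weyl \<Rightarrow> 'a weyl \<Rightarrow> 'a weyl" is "\<lambda>L M p. L (M p)"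
  by (rule weyl_ops.comp)

instance
proof
  show "(0 :: 'a weyl) \<noteq> 1"
    by transfer (metis zero_neq_one)
qed (transfer; auto simp: weyl_ops_add weyl_ops_zero add_ac fun_eq_iff)+

end

lemma weyl_induct [case_names const x d add mult]:
  assumes "\<And>c. Q (weyl_const c)" "\<And>j. Q (weyl_x j)" "\<And>j. Q (weyl_d j)"
    "\<And>a b. Q a \<Longrightarrow> Q b \<Longrightarrow> Q (a + b)" "\<And>a b. Q a \<Longrightarrow> Q b \<Longrightarrow> Q (a * b)"
  shows "Q P"
proof -
  have "L \<in> weyl_ops \<Longrightarrow> Q (Abs_weyl L)" for L
  proof (induction rule: weyl_ops.induct)
    case (add L M)
    then show ?case
      using assms(4)[OF add.IH] by (simp add: plus_weyl_def Abs_weyl_inverse)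
  next
    case (comp L M)
    then show ?case
      using assms(5)[OF comp.IH] by (simp add: times_weyl_def Abs_weyl_inverse)
  qed (use assms in \<open>auto simp: weyl_const_def weyl_x_def weyl_d_def\<close>)
  then show ?thesis
    by (metis weyl_apply weyl_apply_inverse)
qed

definition weyl_scale :: "complex \<Rightarrow> 'n weyl \<Rightarrow> 'n weyl" where
  "weyl_scale c P = weyl_const c * P"

lemma weyl_const_add: "weyl_const (a + b) = weyl_const a + weyl_const b"
  by transfer (auto simp: single_add distrib_right)
lemma weyl_const_mult: "weyl_const (a * b) = weyl_const a * weyl_const b"
  by transfer (auto simp: mult_single mult.assoc[symmetric])
lemma weyl_const_1 [simp]: "weyl_const 1 = 1"
  by transfer auto
lemma weyl_const_0 [simp]: "weyl_const 0 = 0"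
  by transfer auto

global_interpretation weyl: vector_space "weyl_scale :: complex \<Rightarrow> 'n weyl \<Rightarrow> 'n weyl"
  by unfold_locales
    (simp_all add: weyl_scale_def weyl_const_add weyl_const_mult algebra_simps)

text \<open>The multi-index power \<open>\<Prod>\<^sub>j g\<^sub>j\<^bsup>m\<^sub>j\<^esup>\<close>; it is only used for families \<open>g\<close> whose members commute
  with each other, so the order of the factors is irrelevant.\<close>

definition multi_power :: "('n::finite \<Rightarrow> 'a::monoid_mult) \<Rightarrow> 'n expo \<Rightarrow> 'a" where
  "multi_power g m = Finite_Set.fold (\<lambda>j r. g j ^ Poly_Mapping.lookup m j * r) 1 UNIV"

definition weyl_eval :: "complex poly \<Rightarrow> 'n weyl \<Rightarrow> 'n weyl" where
  "weyl_eval b P = (\<Sum>i\<le>degree b. weyl_scale (coeff b i) (P ^ i))"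


section \<open>The Fourier transform\<close>

text \<open>The Weyl algebra in the coordinates \<open>y\<^sub>j, \<delta>\<^sub>j\<close> is another copy of the same algebra: there,
  \<open>weyl_x j\<close> stands for \<open>y\<^sub>j\<close> and \<open>weyl_d j\<close> for \<open>\<delta>\<^sub>j\<close>. The isomorphism is one of complex
  algebras, and it is determined by its values on generators; existence is
  \<open>is_fourier_inv_ex1\<close>.\<close>

definition is_fourier_inv :: "('n weyl \<Rightarrow> 'n weyl) \<Rightarrow> bool" where
  "is_fourier_inv F \<longleftrightarrow> bij F \<and>
     (\<forall>P Q. F (P + Q) = F P + F Q) \<and> (\<forall>P Q. F (P * Q) = F P * F Q) \<and>
     (\<forall>c. F (weyl_const c) = weyl_const c) \<and>
     (\<forall>j. F (weyl_d j) = weyl_x j) \<and> (\<forall>j. F (weyl_x j) = - weyl_d j)"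

definition fourier_inv :: "'n weyl \<Rightarrow> 'n weyl" where
  "fourier_inv = (THE F. is_fourier_inv F)"


context notes One_nat_def [simp del] begin

lemma finsupp_induct [case_names zero single add]:
  assumes "Q 0" "\<And>m c. Q (Poly_Mapping.single m c)" "\<And>p q. Q p \<Longrightarrow> Q q \<Longrightarrow> Q (p + q)"
  shows "Q (p :: 'k \<Rightarrow>\<^sub>0 'c::monoid_add)"
proof (induction p rule: update_induct)
  case const
  show ?case by (rule assms(1))
next
  case (update f a b)
  have "Poly_Mapping.update a b f = f + Poly_Mapping.single a b"
    using update.hyps
    by (intro poly_mapping_eqI) (auto simp: lookup_update lookup_add lookup_single in_keys_iff when_def)
  then show ?case
    using assms(3)[OF update.IH assms(2)] by simp
qed

lemma expo_eqI: "(\<And>j. Poly_Mapping.lookup m j = Poly_Mapping.lookup k j) \<Longrightarrow> m = (k :: 'n expo)"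
  by (rule poly_mapping_eqI)

lemma expo_induct [case_names zero step]:
  assumes "Q 0" "\<And>i m. Q m \<Longrightarrow> Q (Poly_Mapping.single i 1 + m)"
  shows "Q (m :: 'n::finite expo)"
proof (induction "\<Sum>j\<in>UNIV. Poly_Mapping.lookup m j" arbitrary: m)
  case 0
  then have "m = 0" by (intro expo_eqI) simp
  then show ?case using assms(1) by simp
next
  case (Suc k)
  then obtain i where i: "Poly_Mapping.lookup m i > 0"
    by (metis (no_types, lifting) gr0I nat.distinct(1) sum.neutral)
  define m' where "m' = m - Poly_Mapping.single i 1"
  have m: "m = Poly_Mapping.single i 1 + m'"
    using i by (intro expo_eqI) (auto simp: m'_def lookup_add lookup_minus lookup_single when_def)
  have "(\<Sum>j\<in>UNIV. Poly_Mapping.lookup m j) = 1 + (\<Sum>j\<in>UNIV. Poly_Mapping.lookup m' j)"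
    by (simp add: m lookup_add lookup_single sum.distrib when_def)
  then have "Q m'" using Suc by auto
  then show ?case using assms(2) m by simp
qed

lemma mpartial_scale:
  "mpartial j (Poly_Mapping.single 0 c * p) = Poly_Mapping.single 0 c * mpartial j p"
  by (induction p rule: finsupp_induct)
    (simp_all add: mult_single mpartial_monom mpartial_add distrib_left mult.left_commute)

lemma mpartial_commute: "mpartial i (mpartial j p) = mpartial j (mpartial i p)"
proof (induction p rule: finsupp_induct)
  case (single m c)
  have "m - Poly_Mapping.single j 1 - Poly_Mapping.single i 1 =
        m - Poly_Mapping.single i 1 - Poly_Mapping.single j (1::nat)"
    by (intro expo_eqI) (auto simp: lookup_minus)
  then show ?case
    by (cases "i = j") (auto simp: mpartial_monom lookup_minus lookup_single when_def mult_ac)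
qed (simp_all add: mpartial_add)

lemma mpartial_mvar:
  "mpartial i (mvar j * p) = mvar j * mpartial i p + (if i = j then p else 0)"
proof (induction p rule: finsupp_induct)
  case (single m c)
  show ?case
  proof (cases "i = j")
    case True
    have 1: "Poly_Mapping.single j 1 + m - Poly_Mapping.single j (1::nat) = m"
      by (intro expo_eqI) (auto simp: lookup_minus lookup_add)
    have 2: "Poly_Mapping.single j 1 + (m - Poly_Mapping.single j (1::nat)) = m"
      if "Poly_Mapping.lookup m j \<noteq> 0"
      using that by (intro expo_eqI) (auto simp: lookup_minus lookup_add lookup_single when_def)
    show ?thesis
      using True 1 2
      by (cases "Poly_Mapping.lookup m j = 0")
        (simp_all add: mvar_def mult_single mpartial_monom lookup_add single_add[symmetric] algebra_simps)
  next
    case False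
    have "Poly_Mapping.single j 1 + m - Poly_Mapping.single i (1::nat) =
        Poly_Mapping.single j 1 + (m - Poly_Mapping.single i 1)"
      using False by (intro expo_eqI) (auto simp: lookup_minus lookup_add lookup_single when_def)
    then show ?thesis
      using False by (simp add: mvar_def mult_single mpartial_monom lookup_add lookup_single)
  qed
qed (auto simp add: mpartial_add algebra_simps)

lemma weyl_const_central: "weyl_const c * P = P * weyl_const c"
proof (induction P rule: weyl_induct)
  case (const a)
  then show ?case by (simp add: weyl_const_mult[symmetric] mult.commute)
next
  case (x j)
  then show ?case by transfer (simp add: mult_ac)
next
  case (d j)
  then show ?case by transfer (simp add: mpartial_scale)
next
  case (add a b)
  then show ?case by (simp add: algebra_simps)
next
  case (mult a b)
  then show ?case by (metis mult.assoc)
qed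

lemma weyl_const_left: "P * (weyl_const c * Q) = weyl_const c * (P * Q)"
  by (metis weyl_const_central mult.assoc)

lemma weyl_x_commute: "weyl_x i * weyl_x j = weyl_x j * weyl_x i"
  by transfer (simp add: mult_ac)

lemma weyl_d_commute: "weyl_d i * weyl_d j = weyl_d j * weyl_d i"
  by transfer (simp add: mpartial_commute)

lemma weyl_d_x: "weyl_d i * weyl_x j = weyl_x j * weyl_d i + (if i = j then 1 else 0)"
  by (cases "i = j"; simp; transfer) (auto simp add: mpartial_mvar)

lemma multi_power_zero [simp]: "multi_power (g :: 'a::finite \<Rightarrow> 'b::monoid_mult) 0 = 1"
proof -
  have "Finite_Set.fold (\<lambda>j r. r) (1::'b) A = 1" if "finite A" for A :: "'a set"
  proof -
    interpret comp_fun_commute "\<lambda>(j::'a) (r::'b). r" by unfold_locales auto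
    show ?thesis using that by (induction A) auto
  qed
  then show ?thesis by (simp add: multi_power_def)
qed

lemma multi_power_step:
  fixes g :: "'n::finite \<Rightarrow> 'a::monoid_mult"
  assumes com: "\<And>i j. g i * g j = g j * g i"
  shows "multi_power g (Poly_Mapping.single i 1 + m) = g i * multi_power g m"
proof -
  have compow: "g i * g j ^ k = g j ^ k * g i" for i j k
    by (simp add: com power_commuting_commutes)
  have compow2: "g i ^ l * g j ^ k = g j ^ k * g i ^ l" for i j k l
    by (metis compow power_commuting_commutes)
  have loc: "comp_fun_commute (\<lambda>j r. g j ^ Poly_Mapping.lookup m j * r)" for m :: "'n expo"
    by unfold_locales (auto simp: fun_eq_iff mult.assoc[symmetric] compow2)
  have "Finite_Set.fold (\<lambda>j r. g j ^ Poly_Mapping.lookup (Poly_Mapping.single i 1 + m) j * r) 1 A =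
    (if i \<in> A then g i else 1) * Finite_Set.fold (\<lambda>j r. g j ^ Poly_Mapping.lookup m j * r) 1 A"
    if "finite A" for A
    using that
  proof (induction A)
    case empty
    then show ?case by simp
  next
    case (insert a A)
    note ins = comp_fun_commute_on.fold_insert[OF loc[unfolded comp_fun_commute_def'] subset_UNIV insert.hyps]
    have pow: "g a ^ Poly_Mapping.lookup (Poly_Mapping.single i 1 + m) a =
        (if i = a then g i else 1) * g a ^ Poly_Mapping.lookup m a"
      by (simp add: lookup_add lookup_single power_add)
    show ?case
      unfolding ins insert.IH pow using insert.hyps
      by (auto simp: mult.assoc[symmetric] compow)
  qed
  then show ?thesis by (simp add: multi_power_def)
qed

lemma multi_power_commutator:
  fixes g :: "'n::finite \<Rightarrow> 'a::ring_1"
  assumes com: "\<And>i j. g i * g j = g j * g i"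
    and h: "\<And>i. h * g i = g i * h + (if i = j then 1 else 0)"
  shows "h * multi_power g m = multi_power g m * h
    + of_nat (Poly_Mapping.lookup m j) * multi_power g (m - Poly_Mapping.single j 1)"
proof (induction m rule: expo_induct)
  case zero
  then show ?case by simp
next
  case (step i m)
  note st = multi_power_step[OF com]
  have "h * multi_power g (Poly_Mapping.single i 1 + m) =
     g i * (h * multi_power g m) + (if i = j then multi_power g m else 0)"
    by (simp add: st mult.assoc[symmetric] h distrib_right)
  also have "\<dots> = multi_power g (Poly_Mapping.single i 1 + m) * h +
     (g i * (of_nat (Poly_Mapping.lookup m j) * multi_power g (m - Poly_Mapping.single j 1)) +
      (if i = j then multi_power g m else 0))"
    by (simp add: st step distrib_left mult.assoc add.assoc)
  also have "g i * (of_nat (Poly_Mapping.lookup m j) * multi_power g (m - Poly_Mapping.single j 1)) =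
     of_nat (Poly_Mapping.lookup m j) * multi_power g (Poly_Mapping.single i 1 + (m - Poly_Mapping.single j 1))"
    unfolding st by (metis mult.assoc mult_of_nat_commute)
  also have "of_nat (Poly_Mapping.lookup m j) * multi_power g (Poly_Mapping.single i 1 + (m - Poly_Mapping.single j 1)) +
      (if i = j then multi_power g m else 0) =
     of_nat (Poly_Mapping.lookup (Poly_Mapping.single i 1 + m) j) *
      multi_power g (Poly_Mapping.single i 1 + m - Poly_Mapping.single j 1)"
  proof (cases "i = j")
    case True
    have 1: "Poly_Mapping.single j 1 + m - Poly_Mapping.single j (1::nat) = m"
      by (intro expo_eqI) (auto simp: lookup_minus lookup_add)
    have 2: "Poly_Mapping.single j 1 + (m - Poly_Mapping.single j (1::nat)) = m"
      if "Poly_Mapping.lookup m j \<noteq> 0"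
      using that by (intro expo_eqI) (auto simp: lookup_minus lookup_add lookup_single when_def)
    show ?thesis
      using True 1 2
      by (cases "Poly_Mapping.lookup m j = 0") (simp_all add: lookup_add algebra_simps)
  next
    case False
    have "Poly_Mapping.single i 1 + m - Poly_Mapping.single j (1::nat) =
        Poly_Mapping.single i 1 + (m - Poly_Mapping.single j 1)"
      using False by (intro expo_eqI) (auto simp: lookup_minus lookup_add lookup_single when_def)
    then show ?thesis
      using False by (simp add: lookup_add lookup_single)
  qed
  finally show ?case .
qed

lemma weyl_apply_add: "weyl_apply (P + Q) p = weyl_apply P p + weyl_apply Q p"
  by transfer simp
lemma weyl_apply_mult: "weyl_apply (P * Q) p = weyl_apply P (weyl_apply Q p)"
  by transfer simp
lemma weyl_apply_one [simp]: "weyl_apply 1 p = p"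
  by transfer simp
lemma weyl_apply_zero [simp]: "weyl_apply 0 p = 0"
  by transfer simp
lemma weyl_apply_sum: "weyl_apply (\<Sum>k\<in>A. f k) p = (\<Sum>k\<in>A. weyl_apply (f k) p)"
  by (induction A rule: infinite_finite_induct) (simp_all add: weyl_apply_add)
lemma weyl_apply_const: "weyl_apply (weyl_const c) p = Poly_Mapping.single 0 c * p"
  by transfer simp

lemma weyl_apply_x_power:
  "weyl_apply (multi_power weyl_x m) p = Poly_Mapping.single m 1 * p"
proof (induction m arbitrary: p rule: expo_induct)
  case (step i m)
  have "weyl_apply (weyl_x i) q = Poly_Mapping.single (Poly_Mapping.single i 1) 1 * q" for q
    by transfer (simp add: mvar_def)
  then show ?case
    by (simp add: multi_power_step weyl_x_commute weyl_apply_mult step mult.assoc[symmetric] mult_single)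
qed simp

lemma weyl_apply_d_power:
  "weyl_apply (multi_power weyl_d m) (Poly_Mapping.single k c) =
   Poly_Mapping.single (k - m)
     ((\<Prod>j\<in>UNIV. \<Prod>i<Poly_Mapping.lookup m j. of_nat (Poly_Mapping.lookup k j - i)) * c)"
proof (induction m rule: expo_induct)
  case (step j m)
  have d: "weyl_apply (weyl_d j) = mpartial j" by transfer simp
  have e: "k - m - Poly_Mapping.single j 1 = k - (Poly_Mapping.single j 1 + m)"
    by (intro expo_eqI) (auto simp: lookup_minus lookup_add)
  let ?F = "\<lambda>m l. \<Prod>i<Poly_Mapping.lookup m l. of_nat (Poly_Mapping.lookup k l - i) :: complex"
  have "?F (Poly_Mapping.single j 1 + m) l = ?F m l *
      (if l = j then of_nat (Poly_Mapping.lookup (k - m) j) else 1)" for l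
    by (auto simp: lookup_add lookup_single lookup_minus Suc_eq_plus1_left[symmetric])
  then have "(\<Prod>l\<in>UNIV. ?F (Poly_Mapping.single j 1 + m) l) =
     of_nat (Poly_Mapping.lookup (k - m) j) * (\<Prod>l\<in>UNIV. ?F m l)"
    by (simp add: prod.distrib)
  then show ?case
    by (simp add: multi_power_step weyl_d_commute weyl_apply_mult step d mpartial_monom mult.assoc e)
qed simp

definition normal_sum ::
    "('n::finite \<Rightarrow> 'n weyl) \<Rightarrow> ('n \<Rightarrow> 'n weyl) \<Rightarrow> ('n expo \<times> 'n expo \<Rightarrow>\<^sub>0 complex) \<Rightarrow> 'n weyl" where
  "normal_sum g h f = (\<Sum>k\<in>Poly_Mapping.keys f. weyl_const (Poly_Mapping.lookup f k) *
     (multi_power g (fst k) * multi_power h (snd k)))"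

lemma normal_sum_superset:
  assumes "finite S" "Poly_Mapping.keys f \<subseteq> S"
  shows "normal_sum g h f = (\<Sum>k\<in>S. weyl_const (Poly_Mapping.lookup f k) *
     (multi_power g (fst k) * multi_power h (snd k)))"
  unfolding normal_sum_def
  by (rule sum.mono_neutral_left) (use assms in \<open>auto simp: in_keys_iff\<close>)

lemma normal_sum_add: "normal_sum g h (f + f') = normal_sum g h f + normal_sum g h f'"
proof -
  let ?S = "Poly_Mapping.keys f \<union> Poly_Mapping.keys f'"
  have "Poly_Mapping.keys (f + f') \<subseteq> ?S" by (rule Poly_Mapping.keys_add)
  then show ?thesis
    by (simp add: normal_sum_superset[of ?S] lookup_add weyl_const_add distrib_right sum.distrib)
qed

lemma normal_sum_zero [simp]: "normal_sum g h 0 = 0"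
  by (simp add: normal_sum_def)

lemma normal_sum_single:
  "normal_sum g h (Poly_Mapping.single k c) =
     weyl_const c * (multi_power g (fst k) * multi_power h (snd k))"
  by (subst normal_sum_superset[of "{k}"]) auto

lemma normal_sum_eq_0:
  assumes "normal_sum weyl_x weyl_d f = 0"
  shows "f = 0"
proof (rule ccontr)
  assume "f \<noteq> 0"
  let ?deg = "\<lambda>m. \<Sum>j\<in>UNIV. Poly_Mapping.lookup (m :: 'a expo) j"
  have "\<exists>k. k \<in> Poly_Mapping.keys f"
    using \<open>f \<noteq> 0\<close> by (metis in_keys_iff lookup_zero poly_mapping_eqI)
  then obtain k0 where k0: "k0 \<in> Poly_Mapping.keys f"
    and min: "\<And>k. k \<in> Poly_Mapping.keys f \<Longrightarrow> ?deg (snd k0) \<le> ?deg (snd k)"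
    using ex_has_least_nat[of "\<lambda>k. k \<in> Poly_Mapping.keys f" _ "\<lambda>k. ?deg (snd k)"] by blast
  let ?c = "\<lambda>m. \<Prod>j\<in>UNIV. \<Prod>i<Poly_Mapping.lookup m j.
     of_nat (Poly_Mapping.lookup (snd k0) j - i) :: complex"
  have c0: "?c (snd k0) \<noteq> 0" by simp
  have term0: "weyl_apply (weyl_const (Poly_Mapping.lookup f k) *
      (multi_power weyl_x (fst k) * multi_power weyl_d (snd k))) (Poly_Mapping.single (snd k0) 1) =
     (if snd k = snd k0 then Poly_Mapping.single (fst k) (Poly_Mapping.lookup f k * ?c (snd k0)) else 0)"
    if k: "k \<in> Poly_Mapping.keys f" for k
  proof (cases "snd k = snd k0")
    case True
    then show ?thesis
      by (simp add: weyl_apply_mult weyl_apply_d_power weyl_apply_x_power weyl_apply_const mult_single)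
  next
    case False
    have "\<exists>j. Poly_Mapping.lookup (snd k) j > Poly_Mapping.lookup (snd k0) j"
    proof (rule ccontr)
      assume "\<not> ?thesis"
      then have le: "\<And>j. Poly_Mapping.lookup (snd k) j \<le> Poly_Mapping.lookup (snd k0) j"
        by (simp add: not_less)
      obtain j where "Poly_Mapping.lookup (snd k) j \<noteq> Poly_Mapping.lookup (snd k0) j"
        using False expo_eqI[of "snd k" "snd k0"] by auto
      then have "?deg (snd k) < ?deg (snd k0)"
        by (intro sum_strict_mono_ex1) (use le in \<open>auto simp: le_less\<close>)
      then show False using min[OF k] by simp
    qed
    then obtain j where "Poly_Mapping.lookup (snd k0) j \<in> {..<Poly_Mapping.lookup (snd k) j}"
      by auto
    then have "(\<Prod>i<Poly_Mapping.lookup (snd k) j.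
       of_nat (Poly_Mapping.lookup (snd k0) j - i) :: complex) = 0"
      by (intro prod_zero) auto
    then have "?c (snd k) = 0"
      by (intro prod_zero) auto
    then show ?thesis
      unfolding weyl_apply_mult weyl_apply_d_power weyl_apply_x_power weyl_apply_const
      using False by (simp del: prod_zero_iff)
  qed
  have "0 = weyl_apply (normal_sum weyl_x weyl_d f) (Poly_Mapping.single (snd k0) 1)"
    by (simp add: assms)
  also have "\<dots> = (\<Sum>k\<in>Poly_Mapping.keys f. if snd k = snd k0
      then Poly_Mapping.single (fst k) (Poly_Mapping.lookup f k * ?c (snd k0)) else 0)"
    unfolding normal_sum_def weyl_apply_sum by (rule sum.cong) (simp_all only: term0)
  finally have "0 = Poly_Mapping.lookup (\<Sum>k\<in>Poly_Mapping.keys f. if snd k = snd k0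
      then Poly_Mapping.single (fst k) (Poly_Mapping.lookup f k * ?c (snd k0)) else 0) (fst k0)"
    by simp
  also have "\<dots> = (\<Sum>k\<in>Poly_Mapping.keys f. if k = k0 then Poly_Mapping.lookup f k * ?c (snd k0) else 0)"
    unfolding lookup_sum
    by (rule sum.cong) (auto simp: lookup_single when_def prod_eq_iff)
  also have "\<dots> = Poly_Mapping.lookup f k0 * ?c (snd k0)"
    using k0 by simp
  finally show False
    using k0 c0 by (simp add: in_keys_iff)
qed

definition fourier_rel :: "'n::finite weyl \<Rightarrow> 'n weyl \<Rightarrow> bool" where
  "fourier_rel P Q \<longleftrightarrow>
     (\<exists>f. P = normal_sum weyl_x weyl_d f \<and> Q = normal_sum (\<lambda>j. - weyl_d j) weyl_x f)"

lemma fourier_rel_unique: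
  assumes "fourier_rel P Q" "fourier_rel P Q'"
  shows "Q = Q'"
proof -
  obtain f f' where f: "P = normal_sum weyl_x weyl_d f" "Q = normal_sum (\<lambda>j. - weyl_d j) weyl_x f"
    "P = normal_sum weyl_x weyl_d f'" "Q' = normal_sum (\<lambda>j. - weyl_d j) weyl_x f'"
    using assms unfolding fourier_rel_def by blast
  have "normal_sum weyl_x weyl_d f = normal_sum weyl_x weyl_d (f - f') + normal_sum weyl_x weyl_d f'"
    by (simp flip: normal_sum_add)
  then have "f - f' = 0" using f by (intro normal_sum_eq_0) simp
  then show ?thesis using f by simp
qed

lemma fourier_rel_add: "fourier_rel P Q \<Longrightarrow> fourier_rel P' Q' \<Longrightarrow> fourier_rel (P + P') (Q + Q')"
  unfolding fourier_rel_def by (metis normal_sum_add)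

lemma fourier_rel_single: "fourier_rel (weyl_const c * (multi_power weyl_x m * multi_power weyl_d k))
    (weyl_const c * (multi_power (\<lambda>j. - weyl_d j) m * multi_power weyl_x k))"
  unfolding fourier_rel_def
  by (rule exI[of _ "Poly_Mapping.single (m, k) c"]) (simp add: normal_sum_single)

lemma fourier_rel_one: "fourier_rel 1 1"
  using fourier_rel_single[of 1 0 0] by simp

lemma fourier_rel_zero: "fourier_rel 0 0"
  using fourier_rel_single[of 0 0 0] by simp

lemma fourier_rel_mult_lin:
  assumes single: "\<And>c m k. fourier_rel
      (P * (weyl_const c * (multi_power weyl_x m * multi_power weyl_d k)))
      (Q * (weyl_const c * (multi_power (\<lambda>j. - weyl_d j) m * multi_power weyl_x k)))"
    and R: "fourier_rel R S"
  shows "fourier_rel (P * R) (Q * S)"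
proof -
  have "fourier_rel (P * normal_sum weyl_x weyl_d f) (Q * normal_sum (\<lambda>j. - weyl_d j) weyl_x f)" for f
    by (induction f rule: finsupp_induct)
      (simp_all add: fourier_rel_zero normal_sum_single single normal_sum_add distrib_left fourier_rel_add)
  then show ?thesis using R unfolding fourier_rel_def by metis
qed

lemma fourier_rel_const:
  assumes "fourier_rel R S" shows "fourier_rel (weyl_const c * R) (weyl_const c * S)"
  by (rule fourier_rel_mult_lin[OF _ assms])
    (simp add: mult.assoc[symmetric] weyl_const_mult[symmetric] fourier_rel_single[unfolded mult.assoc[symmetric]])

lemma fourier_rel_x:
  assumes "fourier_rel R S" shows "fourier_rel (weyl_x j * R) (- weyl_d j * S)"
proof (rule fourier_rel_mult_lin[OF _ assms])
  fix c and m k :: "'a expo"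
  have 1: "weyl_x j * (weyl_const c * (multi_power weyl_x m * multi_power weyl_d k)) =
    weyl_const c * (multi_power weyl_x (Poly_Mapping.single j 1 + m) * multi_power weyl_d k)"
    by (simp only: multi_power_step[OF weyl_x_commute] weyl_const_left mult.assoc)
  have "(- weyl_d i) * (- weyl_d j) = (- weyl_d j) * (- weyl_d i)" for i j :: 'a
    by (simp add: weyl_d_commute)
  note st = multi_power_step[of "\<lambda>j. - weyl_d j", OF this]
  have 2: "- weyl_d j * (weyl_const c * (multi_power (\<lambda>j. - weyl_d j) m * multi_power weyl_x k)) =
    weyl_const c * (multi_power (\<lambda>j. - weyl_d j) (Poly_Mapping.single j 1 + m) * multi_power weyl_x k)"
    by (simp only: st weyl_const_left mult.assoc)
  show "fourier_rel (weyl_x j * (weyl_const c * (multi_power weyl_x m * multi_power weyl_d k)))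
     (- weyl_d j * (weyl_const c * (multi_power (\<lambda>j. - weyl_d j) m * multi_power weyl_x k)))"
    unfolding 1 2 by (rule fourier_rel_single)
qed

lemma weyl_const_of_nat: "weyl_const (of_nat n) = of_nat n"
  by (induction n) (simp_all add: weyl_const_add)

lemma fourier_rel_d:
  assumes "fourier_rel R S" shows "fourier_rel (weyl_d j * R) (weyl_x j * S)"
proof (rule fourier_rel_mult_lin[OF _ assms])
  fix c and m k :: "'a expo"
  let ?m = "m - Poly_Mapping.single j 1"
  let ?n = "of_nat (Poly_Mapping.lookup m j)"
  have c1: "weyl_d j * multi_power weyl_x m = multi_power weyl_x m * weyl_d j
      + of_nat (Poly_Mapping.lookup m j) * multi_power weyl_x ?m"
    by (rule multi_power_commutator) (auto simp: weyl_x_commute weyl_d_x)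
  have c2: "weyl_x j * multi_power (\<lambda>j. - weyl_d j) m = multi_power (\<lambda>j. - weyl_d j) m * weyl_x j
      + of_nat (Poly_Mapping.lookup m j) * multi_power (\<lambda>j. - weyl_d j) ?m"
    by (rule multi_power_commutator) (auto simp: weyl_d_commute weyl_d_x)
  have 1: "weyl_d j * (weyl_const c * (multi_power weyl_x m * multi_power weyl_d k)) =
    weyl_const c * (multi_power weyl_x m * multi_power weyl_d (Poly_Mapping.single j 1 + k)) +
    weyl_const (c * ?n) * (multi_power weyl_x ?m * multi_power weyl_d k)"
  proof -
    have "weyl_d j * (weyl_const c * (multi_power weyl_x m * multi_power weyl_d k)) =
       weyl_const c * ((weyl_d j * multi_power weyl_x m) * multi_power weyl_d k)"
      by (simp only: weyl_const_left mult.assoc)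
    then show ?thesis
      by (simp add: c1 multi_power_step[OF weyl_d_commute] weyl_const_mult weyl_const_of_nat
          distrib_right distrib_left mult.assoc)
  qed
  have 2: "weyl_x j * (weyl_const c * (multi_power (\<lambda>j. - weyl_d j) m * multi_power weyl_x k)) =
    weyl_const c * (multi_power (\<lambda>j. - weyl_d j) m * multi_power weyl_x (Poly_Mapping.single j 1 + k)) +
    weyl_const (c * ?n) * (multi_power (\<lambda>j. - weyl_d j) ?m * multi_power weyl_x k)"
  proof -
    have "weyl_x j * (weyl_const c * (multi_power (\<lambda>j. - weyl_d j) m * multi_power weyl_x k)) =
       weyl_const c * ((weyl_x j * multi_power (\<lambda>j. - weyl_d j) m) * multi_power weyl_x k)"
      by (simp only: weyl_const_left mult.assoc)
    then show ?thesis
      by (simp add: c2 multi_power_step[OF weyl_x_commute] weyl_const_mult weyl_const_of_nat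
          distrib_right distrib_left mult.assoc)
  qed
  show "fourier_rel (weyl_d j * (weyl_const c * (multi_power weyl_x m * multi_power weyl_d k)))
     (weyl_x j * (weyl_const c * (multi_power (\<lambda>j. - weyl_d j) m * multi_power weyl_x k)))"
    unfolding 1 2 by (intro fourier_rel_add fourier_rel_single)
qed

lemma fourier_rel_mult_ex: "\<exists>Q. \<forall>R S. fourier_rel R S \<longrightarrow> fourier_rel (P * R) (Q * S)"
proof (induction P rule: weyl_induct)
  case (const c)
  then show ?case using fourier_rel_const by blast
next
  case (x j)
  then show ?case using fourier_rel_x by blast
next
  case (d j)
  then show ?case using fourier_rel_d by blast
next
  case (add a b)
  then obtain Q Q' where "\<forall>R S. fourier_rel R S \<longrightarrow> fourier_rel (a * R) (Q * S)"
    "\<forall>R S. fourier_rel R S \<longrightarrow> fourier_rel (b * R) (Q' * S)" by blast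
  then show ?case
    by (intro exI[of _ "Q + Q'"]) (simp add: distrib_right fourier_rel_add)
next
  case (mult a b)
  then obtain Q Q' where "\<forall>R S. fourier_rel R S \<longrightarrow> fourier_rel (a * R) (Q * S)"
    "\<forall>R S. fourier_rel R S \<longrightarrow> fourier_rel (b * R) (Q' * S)" by blast
  then show ?case
    by (intro exI[of _ "Q * Q'"]) (simp add: mult.assoc)
qed

lemma fourier_rel_mult: "fourier_rel P Q \<Longrightarrow> fourier_rel R S \<Longrightarrow> fourier_rel (P * R) (Q * S)"
  by (metis fourier_rel_mult_ex fourier_rel_one fourier_rel_unique mult.right_neutral)

lemma fourier_rel_ex1: "\<exists>!Q. fourier_rel P Q"
  by (metis fourier_rel_mult_ex fourier_rel_one fourier_rel_unique mult.right_neutral)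

lemma is_fourier_inv_unique:
  assumes "is_fourier_inv F" "is_fourier_inv G"
  shows "F = G"
proof
  show "F P = G P" for P
    by (induction P rule: weyl_induct) (use assms in \<open>simp_all add: is_fourier_inv_def\<close>)
qed

theorem is_fourier_inv_ex1: "\<exists>!F :: 'n::finite weyl \<Rightarrow> 'n weyl. is_fourier_inv F"
proof -
  define F where "F P = (THE Q :: 'n weyl. fourier_rel P Q)" for P
  have F: "fourier_rel P (F P)" for P
    unfolding F_def by (rule theI') (rule fourier_rel_ex1)
  have FI: "F P = Q" if "fourier_rel P Q" for P Q
    using F that fourier_rel_unique by blast
  have add: "F (P + Q) = F P + F Q" for P Q by (intro FI fourier_rel_add F)
  have mult: "F (P * Q) = F P * F Q" for P Q by (intro FI fourier_rel_mult F)
  have const: "F (weyl_const c) = weyl_const c" for c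
    using FI[OF fourier_rel_const[OF fourier_rel_one, of c]] by simp
  have x: "F (weyl_x j) = - weyl_d j" for j
    using FI[OF fourier_rel_x[OF fourier_rel_one, of j]] by simp
  have d: "F (weyl_d j) = weyl_x j" for j
    using FI[OF fourier_rel_d[OF fourier_rel_one, of j]] by simp
  have zero: "F 0 = 0" using FI[OF fourier_rel_zero] .
  have minus: "F (- P) = - F P" for P
    using add[of P "- P"] zero by (simp add: eq_neg_iff_add_eq_0 add.commute)
  have four: "F (F (F (F P))) = P" for P
    by (induction P rule: weyl_induct) (simp_all add: const x d minus add mult)
  have "bij F"
    by (rule o_bij[of "F \<circ> F \<circ> F"]) (simp_all add: fun_eq_iff four)
  then have "is_fourier_inv F"
    by (simp add: is_fourier_inv_def add mult const x d)
  then show ?thesis using is_fourier_inv_unique by blast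
qed

lemma is_fourier_inv_fourier_inv: "is_fourier_inv (fourier_inv :: 'n::finite weyl \<Rightarrow> 'n weyl)"
  unfolding fourier_inv_def by (rule theI'[OF is_fourier_inv_ex1])

end


section \<open>Toric ideals and hypergeometric ideals\<close>

definition pos_expo :: "int ^ 'n::finite \<Rightarrow> 'n expo" where
  "pos_expo v = Abs_poly_mapping (\<lambda>j. nat (max 0 (v $ j)))"

text \<open>\<open>R\<^sub>A\<close> is \<open>'n mpoly\<close> with \<open>mvar j\<close> playing the role of \<open>\<partial>\<^sub>j\<close>.\<close>

definition toric_ideal :: "int ^ 'n::finite ^ 'd::finite \<Rightarrow> 'n mpoly set" where
  "toric_ideal A = left_ideal hull
     {Poly_Mapping.single (pos_expo v) 1 - Poly_Mapping.single (pos_expo (- v)) 1 | v. A *v v = 0}"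

definition weyl_of_R :: "'n::finite mpoly \<Rightarrow> 'n weyl" where
  "weyl_of_R p = (\<Sum>m\<in>Poly_Mapping.keys p.
     weyl_scale (Poly_Mapping.lookup p m) (multi_power weyl_d m))"

definition euler_op :: "int ^ 'n::finite ^ 'd::finite \<Rightarrow> 'd \<Rightarrow> 'n weyl" where
  "euler_op A i = (\<Sum>j\<in>UNIV. of_int (A $ i $ j) * weyl_x j * weyl_d j)"

definition hypergeometric_ideal ::
    "int ^ 'n::finite ^ 'd::finite \<Rightarrow> complex ^ 'd \<Rightarrow> 'n weyl set" where
  "hypergeometric_ideal A \<beta> = left_ideal hull
     (weyl_of_R ` toric_ideal A \<union> range (\<lambda>i. euler_op A i - weyl_const (\<beta> $ i)))"


section \<open>Degrees and quasi-degrees\<close>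

definition expo_deg :: "int ^ 'n::finite ^ 'd::finite \<Rightarrow> 'n expo \<Rightarrow> int ^ 'd" where
  "expo_deg A m = (\<Sum>j\<in>UNIV. int (Poly_Mapping.lookup m j) *s column j A)"

definition homogeneous :: "int ^ 'n::finite ^ 'd::finite \<Rightarrow> int ^ 'd \<Rightarrow> 'n mpoly \<Rightarrow> bool" where
  "homogeneous A u p \<longleftrightarrow> (\<forall>m\<in>Poly_Mapping.keys p. expo_deg A m = u)"

text \<open>An element of \<open>S\<^sub>A = R\<^sub>A/I\<^sub>A\<close> is a coset \<open>p +o I\<^sub>A\<close>; an element of \<open>N = S\<^sub>A/\<partial>\<^sub>tS\<^sub>A\<close> is a
  coset, with respect to the addition of cosets in \<open>S\<^sub>A\<close>, of the submodule \<open>\<partial>\<^sub>tS\<^sub>A\<close>.\<close>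

definition toric_class :: "int ^ 'n::finite ^ 'd::finite \<Rightarrow> 'n mpoly \<Rightarrow> 'n mpoly set" where
  "toric_class A p = p +o toric_ideal A"

definition toric_multiples :: "int ^ 'n::finite ^ 'd::finite \<Rightarrow> 'n \<Rightarrow> 'n mpoly set set" where
  "toric_multiples A t = {toric_class A (mvar t * p) | p. True}"

definition N_class ::
    "int ^ 'n::finite ^ 'd::finite \<Rightarrow> 'n \<Rightarrow> 'n mpoly set \<Rightarrow> 'n mpoly set set" where
  "N_class A t s = s +o toric_multiples A t"

definition N_component ::
    "int ^ 'n::finite ^ 'd::finite \<Rightarrow> 'n \<Rightarrow> int ^ 'd \<Rightarrow> 'n mpoly set set set" where
  "N_component A t u = {N_class A t (toric_class A p) | p. homogeneous A u p}"

definition deg_N :: "int ^ 'n::finite ^ 'd::finite \<Rightarrow> 'n \<Rightarrow> (int ^ 'd) set" where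
  "deg_N A t = {u. \<exists>x\<in>N_component A t u. x \<noteq> N_class A t (toric_class A 0)}"

definition cvec :: "int ^ 'd::finite \<Rightarrow> complex ^ 'd" where
  "cvec u = (\<chi> i. of_int (u $ i))"

definition qdeg_N :: "int ^ 'n::finite ^ 'd::finite \<Rightarrow> 'n \<Rightarrow> (complex ^ 'd) set" where
  "qdeg_N A t = zariski_closure (cvec ` deg_N A t)"


section \<open>The b-function\<close>

definition V_filtration :: "'n::finite \<Rightarrow> int \<Rightarrow> 'n weyl set" where
  "V_filtration t i = weyl.span
     {multi_power weyl_d \<mu> * multi_power weyl_x \<nu> | \<mu> \<nu>.
        int (Poly_Mapping.lookup \<nu> t) - int (Poly_Mapping.lookup \<mu> t) \<ge> i}"

definition b_condition :: "'n::finite weyl set \<Rightarrow> 'n \<Rightarrow> complex poly \<Rightarrow> bool" where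
  "b_condition J t b \<longleftrightarrow> lead_coeff b = 1 \<and>
     weyl_eval b (- weyl_d t * weyl_x t) \<in> J + V_filtration t 1"

text \<open>\<open>b\<close> is the b-function along \<open>y\<^sub>t = 0\<close> of the quotient of the Weyl algebra by the left ideal
  \<open>J\<close>, in the argument \<open>-\<delta>\<^sub>t y\<^sub>t\<close>.\<close>

definition is_b_function :: "'n::finite weyl set \<Rightarrow> 'n \<Rightarrow> complex poly \<Rightarrow> bool" where
  "is_b_function J t b \<longleftrightarrow> b_condition J t b \<and>
     (\<forall>q. b_condition J t q \<longrightarrow> degree b \<le> degree q)"

end

theory Submission
  imports Defs
begin

text \<open>Let \<open>f\<close> vanish on the degrees of \<open>N\<close>. Modulo the Euler operators, \<open>f(\<beta> - \<theta>\<^sub>t a\<^sub>t)\<close> equals the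
  value of \<open>f\<close> at the sum of the \<open>\<theta>\<^sub>j a\<^sub>j\<close> with \<open>j \<noteq> t\<close>, which has a normal form with terms
  \<open>c\<^sub>m x\<^sup>m \<partial>\<^sup>m\<close>, \<open>m\<^sub>t = 0\<close>. The coefficient \<open>c\<^sub>m\<close> is a combination of the values \<open>f(A k)\<close> with
  \<open>k \<le> m\<close>, so it vanishes unless \<open>\<partial>\<^sup>m \<in> I\<^sub>A + \<partial>\<^sub>t R\<^sub>A\<close>; in that case \<open>x\<^sup>m \<partial>\<^sup>m\<close> lies in the
  hypergeometric ideal up to an operator whose Fourier transform is in \<open>V\<^sup>1\<close>. Hence \<open>b(s)\<close>
  divides \<open>f(\<beta> - s a\<^sub>t)\<close>.\<close>

section \<open>Evaluation of polynomials\<close>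

context notes One_nat_def [simp del] begin

lemma mpoly_eval_superset:
  assumes "finite S" "Poly_Mapping.keys f \<subseteq> S"
  shows "mpoly_eval f z = (\<Sum>m\<in>S. Poly_Mapping.lookup f m * (\<Prod>i\<in>UNIV. (z $ i) ^ Poly_Mapping.lookup m i))"
  unfolding mpoly_eval_def
  by (rule sum.mono_neutral_left) (use assms in \<open>auto simp: in_keys_iff\<close>)

lemma mpoly_eval_zero [simp]: "mpoly_eval 0 z = 0"
  by (simp add: mpoly_eval_def)

lemma mpoly_eval_add: "mpoly_eval (f + g) z = mpoly_eval f z + mpoly_eval g z"
proof -
  let ?S = "Poly_Mapping.keys f \<union> Poly_Mapping.keys g"
  have "Poly_Mapping.keys (f + g) \<subseteq> ?S" by (rule Poly_Mapping.keys_add)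
  then show ?thesis
    by (simp add: mpoly_eval_superset[of ?S] lookup_add distrib_right sum.distrib)
qed

lemma mpoly_eval_single:
  "mpoly_eval (Poly_Mapping.single m c) z = c * (\<Prod>i\<in>UNIV. (z $ i) ^ Poly_Mapping.lookup m i)"
  by (subst mpoly_eval_superset[of "{m}"]) auto

lemma mpoly_eval_single_step:
  "mpoly_eval (Poly_Mapping.single (Poly_Mapping.single i 1 + m) c) z
    = z $ i * mpoly_eval (Poly_Mapping.single m c) z"
proof -
  have "(z $ l) ^ Poly_Mapping.lookup (Poly_Mapping.single i 1 + m) l
     = (if l = i then z $ i else 1) * (z $ l) ^ Poly_Mapping.lookup m l" for l
    by (simp add: lookup_add lookup_single power_add)
  then show ?thesis by (simp add: mpoly_eval_single prod.distrib mult.left_commute)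
qed

section \<open>Substitution of an operator into a polynomial in one variable\<close>

lemma weyl_eval_superset:
  assumes "degree p \<le> n"
  shows "weyl_eval p P = (\<Sum>i\<le>n. weyl_const (coeff p i) * P ^ i)"
  unfolding weyl_eval_def weyl_scale_def
  by (rule sum.mono_neutral_left) (use assms in \<open>auto simp: coeff_eq_0\<close>)

lemma weyl_eval_zero [simp]: "weyl_eval 0 P = 0"
  by (simp add: weyl_eval_superset[of _ 0])

lemma weyl_eval_add: "weyl_eval (p + q) P = weyl_eval p P + weyl_eval q P"
proof -
  let ?n = "max (degree p) (degree q)"
  have "degree (p + q) \<le> ?n" by (rule degree_add_le) auto
  then show ?thesis
    by (simp add: weyl_eval_superset[of _ ?n] weyl_const_add distrib_right sum.distrib)
qed

lemma weyl_eval_smult: "weyl_eval (smult a p) P = weyl_const a * weyl_eval p P"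
  by (simp add: weyl_eval_superset[of _ "degree p"] degree_smult_le weyl_const_mult
      sum_distrib_left mult.assoc)

lemma weyl_eval_pCons: "weyl_eval (pCons a p) P = weyl_const a + P * weyl_eval p P"
proof -
  have "weyl_eval (pCons a p) P = (\<Sum>i\<le>Suc (degree p). weyl_const (coeff (pCons a p) i) * P ^ i)"
    by (rule weyl_eval_superset) (rule degree_pCons_le)
  also have "\<dots> = weyl_const a + (\<Sum>i\<le>degree p. weyl_const (coeff p i) * (P * P ^ i))"
    by (subst sum.atMost_Suc_shift) simp
  finally show ?thesis
    by (simp add: weyl_eval_superset[of p "degree p"] sum_distrib_left weyl_const_left)
qed

text \<open>Multiplicativity survives noncommutativity because scalars are central, which enters
  through \<open>weyl_eval_pCons\<close>, and only powers of the one operator \<open>P\<close>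
  occur.\<close>

lemma weyl_eval_mult: "weyl_eval (p * q) P = weyl_eval p P * weyl_eval q P"
  by (induction p)
    (simp_all add: weyl_eval_pCons weyl_eval_add weyl_eval_smult mult_pCons_left distrib_right mult.assoc)


section \<open>The Fourier transform and the V-filtration\<close>

lemma
  shows fourier_inv_add: "fourier_inv (P + Q) = fourier_inv P + fourier_inv (Q :: 'n::finite weyl)"
    and fourier_inv_mult: "fourier_inv (P * Q) = fourier_inv P * fourier_inv Q"
    and fourier_inv_const: "fourier_inv (weyl_const c :: 'n weyl) = weyl_const c"
    and fourier_inv_d: "fourier_inv (weyl_d j :: 'n weyl) = weyl_x j"
    and fourier_inv_x: "fourier_inv (weyl_x j :: 'n weyl) = - weyl_d j"
    and surj_fourier_inv: "surj (fourier_inv :: 'n weyl \<Rightarrow> _)"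
  using is_fourier_inv_fourier_inv[where 'n='n] by (auto simp: is_fourier_inv_def bij_def)

lemma fourier_inv_zero [simp]: "fourier_inv (0 :: 'n::finite weyl) = 0"
  using fourier_inv_const[of 0] by simp

lemma fourier_inv_weyl_eval:
  "fourier_inv (weyl_eval p P) = weyl_eval p (fourier_inv (P :: 'n::finite weyl))"
  by (induction p)
    (simp_all add: weyl_eval_pCons fourier_inv_add fourier_inv_mult fourier_inv_const)

text \<open>Closure under an arbitrary left factor uses surjectivity: \<open>r\<close> is pulled
  back to the source, where the ideal property applies.\<close>

lemma left_ideal_fourier_inv_image:
  fixes J :: "'n::finite weyl set"
  assumes "left_ideal J"
  shows "left_ideal (fourier_inv ` J)"
proof -
  have "r * fourier_inv a \<in> fourier_inv ` J" if "a \<in> J" for r a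
  proof -
    obtain r' where "r = fourier_inv r'" using surj_fourier_inv by blast
    then show ?thesis
      using assms that by (auto simp: left_ideal_def fourier_inv_mult[symmetric])
  qed
  moreover have "fourier_inv a + fourier_inv b \<in> fourier_inv ` J" if "a \<in> J" "b \<in> J" for a b
    using assms that by (auto simp: left_ideal_def fourier_inv_add[symmetric])
  moreover have "0 \<in> fourier_inv ` J"
    using assms by (metis fourier_inv_zero image_eqI left_ideal_def)
  ultimately show ?thesis by (auto simp: left_ideal_def)
qed

section \<open>Fourier images of monomials and their V-degree\<close>

lemma weyl_const_uminus: "weyl_const (- c) = - weyl_const c"
  using weyl_const_add[of c "- c"] by (simp add: eq_neg_iff_add_eq_0 add.commute)

text \<open>The scalar is the sign (-1)^|m|; its existence is enough for membership in a linear
  span.\<close>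

lemma multi_power_minus_d: "\<exists>c. multi_power (\<lambda>j. - weyl_d j) m = weyl_const c * multi_power weyl_d m"
proof (induction m rule: expo_induct)
  case zero
  show ?case by (rule exI[of _ 1]) simp
next
  case (step i m)
  then obtain c where c: "multi_power (\<lambda>j. - weyl_d j) m = weyl_const c * multi_power weyl_d m"
    by blast
  show ?case
    by (rule exI[of _ "- c"])
      (simp add: multi_power_step weyl_d_commute c weyl_const_left weyl_const_uminus)
qed

lemma fourier_inv_x_power:
  "fourier_inv (multi_power weyl_x m) = multi_power (\<lambda>j. - weyl_d j) m"
  by (induction m rule: expo_induct)
    (simp_all add: multi_power_step weyl_x_commute weyl_d_commute fourier_inv_mult fourier_inv_x
      fourier_inv_const[of 1, simplified])

lemma fourier_inv_d_power: "fourier_inv (multi_power weyl_d m) = multi_power weyl_x m"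
  by (induction m rule: expo_induct)
    (simp_all add: multi_power_step weyl_x_commute weyl_d_commute fourier_inv_mult fourier_inv_d
      fourier_inv_const[of 1, simplified])

text \<open>The Fourier transform sends x^\<mu> \<partial>^\<nu> to a sign times \<delta>^\<mu>
  y^\<nu>, already in the order of the monomials that span \<open>V_filtration\<close>.\<close>

lemma fourier_inv_monomial_in_V_filtration:
  assumes "int (Poly_Mapping.lookup \<nu> t) - int (Poly_Mapping.lookup \<mu> t) \<ge> i"
  shows "fourier_inv (multi_power weyl_x \<mu> * multi_power weyl_d \<nu>) \<in> V_filtration t i"
proof -
  obtain c where c: "multi_power (\<lambda>j. - weyl_d j) \<mu> = weyl_const c * multi_power weyl_d \<mu>"
    using multi_power_minus_d by blast
  have "weyl_scale c (multi_power weyl_d \<mu> * multi_power weyl_x \<nu>) \<in> V_filtration t i"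
    unfolding V_filtration_def by (intro weyl.span_scale weyl.span_base) (use assms in blast)
  then show ?thesis
    by (simp add: fourier_inv_mult fourier_inv_x_power fourier_inv_d_power c weyl_scale_def mult.assoc)
qed

text \<open>The operator -\<delta>_t y_t has V-degree 0: moving y_t past \<delta>^\<mu> sends
  \<delta>^\<mu> y^\<nu> to -\<delta>^(\<mu>+e) y^(\<nu>+e) plus \<mu>_t times itself.\<close>

lemma d_x_mult_V_filtration:
  assumes "P \<in> V_filtration t i"
  shows "(- weyl_d t * weyl_x t) * P \<in> V_filtration t i"
  using assms unfolding V_filtration_def
proof (induction rule: weyl.span_induct_alt)
  case base
  show ?case by (simp add: weyl.span_zero)
next
  case (step c P Q)
  let ?V = "weyl.span {multi_power weyl_d \<mu> * multi_power weyl_x \<nu> | \<mu> \<nu>.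
        int (Poly_Mapping.lookup \<nu> t) - int (Poly_Mapping.lookup \<mu> t) \<ge> i}"
  let ?T = "- weyl_d t * weyl_x t"
  obtain \<mu> \<nu> where P: "P = multi_power weyl_d \<mu> * multi_power weyl_x \<nu>"
    and i: "int (Poly_Mapping.lookup \<nu> t) - int (Poly_Mapping.lookup \<mu> t) \<ge> i"
    using step(1) by blast
  let ?k = "Poly_Mapping.lookup \<mu> t"
  let ?e = "Poly_Mapping.single t (1::nat)"
  have com: "(- weyl_x t) * multi_power weyl_d \<mu> = multi_power weyl_d \<mu> * (- weyl_x t) +
      of_nat ?k * multi_power weyl_d (\<mu> - ?e)"
    by (rule multi_power_commutator) (auto simp: weyl_d_commute weyl_d_x)
  \<comment> \<open>Truncated subtraction leaves \<open>\<mu> - ?e\<close> equal to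
    \<open>\<mu>\<close> when \<mu>_t = 0; the factor \<open>of_nat ?k\<close> then kills the
    term.\<close>
  have dec: "of_nat ?k * (weyl_d t * multi_power weyl_d (\<mu> - ?e)) = weyl_const (of_nat ?k) * multi_power weyl_d \<mu>"
  proof (cases "?k = 0")
    case False
    then have "?e + (\<mu> - ?e) = \<mu>"
      by (intro expo_eqI) (auto simp: lookup_minus lookup_add lookup_single when_def)
    then have "weyl_d t * multi_power weyl_d (\<mu> - ?e) = multi_power weyl_d \<mu>"
      using multi_power_step[of weyl_d t "\<mu> - ?e", OF weyl_d_commute] by simp
    then show ?thesis by (simp only: weyl_const_of_nat)
  qed simp
  have "?T * P = weyl_d t * ((- weyl_x t * multi_power weyl_d \<mu>) * multi_power weyl_x \<nu>)"
    by (simp add: P mult.assoc)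
  also have "\<dots> = - (weyl_d t * multi_power weyl_d \<mu> * (weyl_x t * multi_power weyl_x \<nu>))
      + (of_nat ?k * (weyl_d t * multi_power weyl_d (\<mu> - ?e))) * multi_power weyl_x \<nu>"
    unfolding com
    by (simp only: distrib_left distrib_right weyl_const_of_nat[symmetric] weyl_const_left mult.assoc
        minus_mult_left[symmetric] minus_mult_right[symmetric])
  also have "\<dots> = - (multi_power weyl_d (?e + \<mu>) * multi_power weyl_x (?e + \<nu>))
      + weyl_scale (of_nat ?k) P"
    by (simp add: dec P weyl_scale_def mult.assoc multi_power_step weyl_d_commute weyl_x_commute)
  also have "\<dots> \<in> ?V"
  proof (intro weyl.span_add weyl.span_neg weyl.span_scale weyl.span_base)
    show "multi_power weyl_d (?e + \<mu>) * multi_power weyl_x (?e + \<nu>) \<in>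
      {multi_power weyl_d \<mu> * multi_power weyl_x \<nu> | \<mu> \<nu>.
        int (Poly_Mapping.lookup \<nu> t) - int (Poly_Mapping.lookup \<mu> t) \<ge> i}"
      by (rule CollectI, rule exI[of _ "?e + \<mu>"], rule exI[of _ "?e + \<nu>"])
        (use i in \<open>simp add: lookup_add\<close>)
  qed (use step(1) in simp)
  finally have "?T * P \<in> ?V" .
  moreover have "?T * (weyl_scale c P + Q) = weyl_scale c (?T * P) + ?T * Q"
    unfolding weyl_scale_def by (simp only: distrib_left weyl_const_left)
  ultimately show ?case
    using step(2) by (simp only: weyl.span_add weyl.span_scale)
qed


section \<open>The b-function divides every annihilating polynomial\<close>

lemma left_ideal_add_V_filtration_scale:
  assumes "left_ideal J" "P \<in> J + V_filtration t i"
  shows "weyl_const c * P \<in> J + V_filtration t i"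
proof -
  obtain p v where "P = p + v" "p \<in> J" "v \<in> V_filtration t i" using assms(2) by (rule set_plus_elim)
  moreover from this have "weyl_const c * p \<in> J" "weyl_const c * v \<in> V_filtration t i"
    using assms(1) weyl.span_scale[of v _ c]
    by (auto simp: left_ideal_def V_filtration_def weyl_scale_def)
  ultimately show ?thesis by (auto simp: distrib_left)
qed

lemma left_ideal_add_V_filtration_add:
  assumes "left_ideal J" "P \<in> J + V_filtration t i" "Q \<in> J + V_filtration t i"
  shows "P + Q \<in> J + V_filtration t i"
proof -
  obtain p v where p: "P = p + v" "p \<in> J" "v \<in> V_filtration t i" using assms(2) by (rule set_plus_elim)
  obtain q w where q: "Q = q + w" "q \<in> J" "w \<in> V_filtration t i" using assms(3) by (rule set_plus_elim)
  have "p + q \<in> J" "v + w \<in> V_filtration t i"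
    using p q assms(1) by (auto simp: left_ideal_def V_filtration_def weyl.span_add)
  then have "(p + q) + (v + w) \<in> J + V_filtration t i" by (rule set_plus_intro)
  then show ?thesis by (simp add: p q add_ac)
qed

text \<open>Left multiplication by \<delta>_t lowers the V-degree, so closure is claimed only for
  polynomials in -\<delta>_t y_t, which preserve both summands.\<close>

lemma weyl_eval_mult_in_left_ideal_add_V_filtration:
  assumes J: "left_ideal J"
    and P: "P \<in> J + V_filtration t i"
  shows "weyl_eval q (- weyl_d t * weyl_x t) * P \<in> J + V_filtration t i"
proof (induction q)
  case 0
  show ?case using left_ideal_add_V_filtration_scale[OF assms, of 0] by simp
next
  case (pCons a q)
  let ?T = "- weyl_d t * weyl_x t"
  obtain p v where p: "weyl_eval q ?T * P = p + v" "p \<in> J" "v \<in> V_filtration t i"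
    using pCons.IH by (rule set_plus_elim)
  have "?T * p + ?T * v \<in> J + V_filtration t i"
    by (intro set_plus_intro d_x_mult_V_filtration p(3)) (use J p(2) in \<open>unfold left_ideal_def, blast\<close>)
  then have "?T * (weyl_eval q ?T * P) \<in> J + V_filtration t i"
    by (simp only: p(1) distrib_left)
  then have "weyl_const a * P + ?T * (weyl_eval q ?T * P) \<in> J + V_filtration t i"
    by (intro left_ideal_add_V_filtration_add left_ideal_add_V_filtration_scale J P)
  then show ?case by (simp only: weyl_eval_pCons distrib_right mult.assoc)
qed

text \<open>By the preceding closure property the remainder of \<open>p\<close> modulo
  \<open>b\<close> satisfies the same membership; if nonzero, it would contradict the minimal degree
  of \<open>b\<close>.\<close>

lemma is_b_function_dvd:
  assumes b: "is_b_function J t b" and J: "left_ideal J"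
    and p: "weyl_eval p (- weyl_d t * weyl_x t) \<in> J + V_filtration t 1"
  shows "b dvd p"
proof (rule ccontr)
  assume "\<not> b dvd p"
  then have r0: "p mod b \<noteq> 0" by (simp add: dvd_eq_mod_eq_0)
  let ?T = "- weyl_d t * weyl_x t"
  have b0: "lead_coeff b = 1" and bT: "weyl_eval b ?T \<in> J + V_filtration t 1"
    using b by (auto simp: is_b_function_def b_condition_def)
  have "p mod b = p + (- (p div b)) * b"
    by (simp add: minus_div_mult_eq_mod[symmetric])
  then have rT: "weyl_eval (p mod b) ?T \<in> J + V_filtration t 1"
    by (simp only: weyl_eval_add weyl_eval_mult)
      (intro left_ideal_add_V_filtration_add J p weyl_eval_mult_in_left_ideal_add_V_filtration bT)
  \<comment> \<open>Rescaled to be monic, as \<open>b_condition\<close> demands.\<close>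
  let ?q = "smult (inverse (lead_coeff (p mod b))) (p mod b)"
  have "b_condition J t ?q"
    unfolding b_condition_def weyl_eval_smult
    using r0 left_ideal_add_V_filtration_scale[OF J rT] by simp
  then have "degree b \<le> degree (p mod b)"
    using b r0 by (auto simp: is_b_function_def dest: spec[of _ ?q])
  moreover have "degree (p mod b) < degree b"
    using r0 by (intro degree_mod_less') (use b0 in auto)
  ultimately show False by simp
qed


section \<open>Operators acting diagonally on monomials\<close>

text \<open>An operator is additive and commutes with scalars, so its values on monomials with
  coefficient 1 determine it.\<close>

lemma weyl_eqI_monomial:
  assumes "\<And>k. weyl_apply P (Poly_Mapping.single k 1) = weyl_apply Q (Poly_Mapping.single k 1)"
  shows "P = Q"
proof -
  have "weyl_apply P p = weyl_apply Q p" for p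
  proof (induction p rule: finsupp_induct)
    case zero
    show ?case
      by (metis weyl_apply weyl_ops_zero)
  next
    case (single m c)
    have "weyl_apply R (Poly_Mapping.single m c) =
        Poly_Mapping.single 0 c * weyl_apply R (Poly_Mapping.single m 1)" for R
    proof -
      have "weyl_apply R (Poly_Mapping.single m c) = weyl_apply (R * weyl_const c) (Poly_Mapping.single m 1)"
        by (simp add: weyl_apply_mult weyl_apply_const mult_single)
      then show ?thesis by (simp add: weyl_const_central[symmetric] weyl_apply_mult weyl_apply_const)
    qed
    then show ?case by (simp add: assms)
  next
    case (add p q)
    have "weyl_apply R (p + q) = weyl_apply R p + weyl_apply R q" for R
      by (rule weyl_ops_add) (rule weyl_apply)
    then show ?case by (simp add: add)
  qed
  then show ?thesis by (metis weyl_apply_inject ext)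
qed

text \<open>The quantifier over \<open>c\<close> makes products immediate: the operator applied last
  meets a monomial that already carries an eigenvalue as coefficient.\<close>

definition has_eigenvalues :: "'n weyl \<Rightarrow> ('n expo \<Rightarrow> complex) \<Rightarrow> bool" where
  "has_eigenvalues P v \<longleftrightarrow>
     (\<forall>k c. weyl_apply P (Poly_Mapping.single k c) = Poly_Mapping.single k (v k * c))"

text \<open>Both operators are diagonal in the basis of monomials. Euler operators are later moved
  past a diagonal \<open>P\<close> in this way.\<close>

lemma has_eigenvalues_commute:
  "has_eigenvalues P v \<Longrightarrow> has_eigenvalues Q w \<Longrightarrow> P * Q = Q * P"
  by (rule weyl_eqI_monomial) (simp add: has_eigenvalues_def weyl_apply_mult mult_ac)

lemma has_eigenvalues_unique:
  assumes "has_eigenvalues P v" "has_eigenvalues P w"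
  shows "v k = w k"
proof -
  have "Poly_Mapping.single k (v k * 1) = Poly_Mapping.single k (w k * 1)"
    using assms unfolding has_eigenvalues_def by (metis (no_types))
  then have "Poly_Mapping.lookup (Poly_Mapping.single k (v k * 1)) k =
      Poly_Mapping.lookup (Poly_Mapping.single k (w k * 1)) k"
    by (rule arg_cong)
  then show ?thesis by simp
qed

lemma has_eigenvalues_zero: "has_eigenvalues 0 (\<lambda>k. 0)"
  by (simp add: has_eigenvalues_def)

lemma has_eigenvalues_add:
  "has_eigenvalues P v \<Longrightarrow> has_eigenvalues Q w \<Longrightarrow> has_eigenvalues (P + Q) (\<lambda>k. v k + w k)"
  by (simp add: has_eigenvalues_def weyl_apply_add single_add distrib_right)

lemma has_eigenvalues_mult:
  "has_eigenvalues P v \<Longrightarrow> has_eigenvalues Q w \<Longrightarrow> has_eigenvalues (P * Q) (\<lambda>k. v k * w k)"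
  by (simp add: has_eigenvalues_def weyl_apply_mult mult.assoc)

lemma has_eigenvalues_const: "has_eigenvalues (weyl_const c) (\<lambda>k. c)"
  by (simp add: has_eigenvalues_def weyl_apply_const mult_single)

lemma has_eigenvalues_sum:
  assumes "\<And>j. j \<in> S \<Longrightarrow> has_eigenvalues (P j) (v j)"
  shows "has_eigenvalues (\<Sum>j\<in>S. P j) (\<lambda>k. \<Sum>j\<in>S. v j k)"
  using assms
  by (induction S rule: infinite_finite_induct) (auto intro: has_eigenvalues_zero has_eigenvalues_add)

lemma has_eigenvalues_theta:
  "has_eigenvalues (weyl_x j * weyl_d j) (\<lambda>k. of_nat (Poly_Mapping.lookup k j))"
proof -
  have d: "weyl_apply (weyl_d j) = mpartial j" by transfer simp
  have x: "weyl_apply (weyl_x j) q = Poly_Mapping.single (Poly_Mapping.single j 1) 1 * q" for q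
    by transfer (simp add: mvar_def)
  have "Poly_Mapping.single (Poly_Mapping.single j 1 + (k - Poly_Mapping.single j 1))
      (of_nat (Poly_Mapping.lookup k j) * c) = Poly_Mapping.single k (of_nat (Poly_Mapping.lookup k j) * c)"
    for k and c :: complex
  proof (cases "Poly_Mapping.lookup k j = 0")
    case False
    then have "Poly_Mapping.single j 1 + (k - Poly_Mapping.single j (1::nat)) = k"
      by (intro expo_eqI) (auto simp: lookup_minus lookup_add lookup_single when_def)
    then show ?thesis by simp
  qed simp
  then show ?thesis
    by (simp add: has_eigenvalues_def weyl_apply_mult d x mpartial_monom mult_single)
qed

text \<open>In each coordinate this is k_j (k_j - 1) ... (k_j - m_j + 1). Natural subtraction does
  no harm: if k_j < m_j, the factor with i = k_j is already zero.\<close>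

definition falling :: "'n::finite expo \<Rightarrow> 'n expo \<Rightarrow> complex" where
  "falling k m = (\<Prod>j\<in>UNIV. \<Prod>i<Poly_Mapping.lookup m j. of_nat (Poly_Mapping.lookup k j - i))"

lemma falling_eq_0:
  assumes "Poly_Mapping.lookup k j < Poly_Mapping.lookup m j"
  shows "falling k m = 0"
proof -
  have "(\<Prod>i<Poly_Mapping.lookup m j. of_nat (Poly_Mapping.lookup k j - i) :: complex) = 0"
    by (rule prod_zero) (use assms in auto)
  then show ?thesis unfolding falling_def by (intro prod_zero) auto
qed

lemma falling_self: "falling m m \<noteq> 0"
  by (simp add: falling_def)

text \<open>x^m \<partial>^m maps x^k to \<open>falling k m\<close> times x^(m + (k - m)), and this
  exponent is k unless the coefficient vanishes.\<close>

lemma has_eigenvalues_x_d_power: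
  "has_eigenvalues (multi_power weyl_x m * multi_power weyl_d m) (\<lambda>k. falling k m)"
proof -
  have "Poly_Mapping.single m 1 * Poly_Mapping.single (k - m) (falling k m * c) =
      Poly_Mapping.single k (falling k m * c)" for k c
  proof (cases "\<exists>j. Poly_Mapping.lookup k j < Poly_Mapping.lookup m j")
    case True
    then show ?thesis by (auto simp: falling_eq_0)
  next
    case False
    then have "m + (k - m) = k"
      by (intro expo_eqI) (simp add: lookup_minus lookup_add not_less)
    then show ?thesis by (simp add: mult_single)
  qed
  then show ?thesis
    by (simp add: has_eigenvalues_def weyl_apply_mult weyl_apply_d_power weyl_apply_x_power
        flip: falling_def)
qed

section \<open>Linear combinations of the operators x^m \<partial>^m\<close>

abbreviation x_d_span :: "'n::finite expo set \<Rightarrow> 'n weyl set" where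
  "x_d_span M \<equiv> weyl.span {multi_power weyl_x m * multi_power weyl_d m | m. m \<in> M}"

text \<open>With \<theta>_j = x_j \<partial>_j, commuting \<partial>_j past x^m gives \<theta>_j x^m
  \<partial>^m = x^(m+e_j) \<partial>^(m+e_j) + m_j x^m \<partial>^m.\<close>

lemma theta_mult_x_d_span:
  assumes P: "P \<in> x_d_span M"
    and M: "\<And>m. m \<in> M \<Longrightarrow> Poly_Mapping.single j 1 + m \<in> M"
  shows "weyl_x j * weyl_d j * P \<in> x_d_span M"
  using P
proof (induction rule: weyl.span_induct_alt)
  case base
  show ?case by (simp add: weyl.span_zero)
next
  case (step c P Q)
  then obtain m where P: "P = multi_power weyl_x m * multi_power weyl_d m" and m: "m \<in> M"
    by blast
  let ?e = "Poly_Mapping.single j (1::nat)"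
  let ?k = "Poly_Mapping.lookup m j"
  have com: "weyl_d j * multi_power weyl_x m = multi_power weyl_x m * weyl_d j
      + of_nat ?k * multi_power weyl_x (m - ?e)"
    by (rule multi_power_commutator) (auto simp: weyl_x_commute weyl_d_x)
  have dec: "weyl_x j * (of_nat ?k * multi_power weyl_x (m - ?e)) = weyl_const (of_nat ?k) * multi_power weyl_x m"
  proof (cases "?k = 0")
    case False
    then have "?e + (m - ?e) = m"
      by (intro expo_eqI) (auto simp: lookup_minus lookup_add lookup_single when_def)
    then have "weyl_x j * multi_power weyl_x (m - ?e) = multi_power weyl_x m"
      using multi_power_step[of weyl_x j "m - ?e", OF weyl_x_commute] by simp
    then show ?thesis by (simp only: weyl_const_of_nat[symmetric] weyl_const_left)
  qed simp
  have "weyl_x j * weyl_d j * P = weyl_x j * (weyl_d j * multi_power weyl_x m) * multi_power weyl_d m"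
    by (simp add: P mult.assoc)
  also have "\<dots> = weyl_x j * multi_power weyl_x m * (weyl_d j * multi_power weyl_d m) +
      weyl_x j * (of_nat ?k * multi_power weyl_x (m - ?e)) * multi_power weyl_d m"
    unfolding com by (simp add: distrib_left distrib_right mult.assoc)
  also have "\<dots> = multi_power weyl_x (?e + m) * multi_power weyl_d (?e + m) + weyl_scale (of_nat ?k) P"
    by (simp add: dec P weyl_scale_def mult.assoc multi_power_step weyl_x_commute weyl_d_commute)
  also have "\<dots> \<in> x_d_span M"
    by (intro weyl.span_add weyl.span_scale weyl.span_base) (use m M step(1) in auto)
  finally have "weyl_x j * weyl_d j * P \<in> x_d_span M" .
  moreover have "weyl_x j * weyl_d j * (weyl_scale c P + Q) =
      weyl_scale c (weyl_x j * weyl_d j * P) + weyl_x j * weyl_d j * Q"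
    unfolding weyl_scale_def by (simp only: distrib_left weyl_const_left)
  ultimately show ?case
    using step(2) by (simp only: weyl.span_add weyl.span_scale)
qed

text \<open>Makes the coefficients of an element of the span available as a finitely supported
  function, so that single ones can be shown to vanish.\<close>

lemma x_d_span_normal_sum:
  assumes "P \<in> x_d_span M"
  shows "\<exists>h. P = normal_sum weyl_x weyl_d h \<and> Poly_Mapping.keys h \<subseteq> (\<lambda>m. (m, m)) ` M"
  using assms
proof (induction rule: weyl.span_induct_alt)
  case base
  show ?case by (rule exI[of _ 0]) simp
next
  case (step c P Q)
  then obtain m h where "P = multi_power weyl_x m * multi_power weyl_d m" "m \<in> M"
    and "Q = normal_sum weyl_x weyl_d h" "Poly_Mapping.keys h \<subseteq> (\<lambda>m. (m, m)) ` M" by blast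
  then show ?case
    using Poly_Mapping.keys_add[of "Poly_Mapping.single (m, m) c" h]
    by (intro exI[of _ "Poly_Mapping.single (m, m) c + h"])
      (auto simp: normal_sum_add normal_sum_single weyl_scale_def split: if_splits)
qed

text \<open>The matrix of the falling factorials \<open>falling k m\<close> is triangular with nonzero diagonal, so the
  coefficients can be recovered from the eigenvalues by recursion along the divisibility order.\<close>

lemma x_d_span_vanishing:
  fixes M K :: "'n::finite expo set"
  assumes P: "P \<in> x_d_span M" and v: "has_eigenvalues P v"
    and K: "\<And>k m. m \<in> K \<Longrightarrow> (\<And>j. Poly_Mapping.lookup k j \<le> Poly_Mapping.lookup m j) \<Longrightarrow> k \<in> K"
    and v0: "\<And>m. m \<in> K \<Longrightarrow> m \<in> M \<Longrightarrow> v m = 0"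
  shows "P \<in> x_d_span (M - K)"
proof -
  obtain h where h: "P = normal_sum weyl_x weyl_d h" "Poly_Mapping.keys h \<subseteq> (\<lambda>m. (m, m)) ` M"
    using x_d_span_normal_sum[OF P] by blast
  have "has_eigenvalues P (\<lambda>k. \<Sum>a\<in>Poly_Mapping.keys h. Poly_Mapping.lookup h a * falling k (fst a))"
    unfolding h(1) normal_sum_def
  proof (intro has_eigenvalues_sum has_eigenvalues_mult[OF has_eigenvalues_const])
    fix a assume "a \<in> Poly_Mapping.keys h"
    then have "snd a = fst a" using h(2) by auto
    then show "has_eigenvalues (multi_power weyl_x (fst a) * multi_power weyl_d (snd a)) (\<lambda>k. falling k (fst a))"
      by (simp add: has_eigenvalues_x_d_power)
  qed
  then have veq: "v k = (\<Sum>a\<in>Poly_Mapping.keys h. Poly_Mapping.lookup h a * falling k (fst a))" for k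
    by (rule has_eigenvalues_unique[OF v])
  \<comment> \<open>Evaluating the eigenvalue at \<open>m\<close> isolates the coefficient of x^m
    \<partial>^m, by induction on the total degree.\<close>
  have zero: "(m, m) \<notin> Poly_Mapping.keys h" if "m \<in> K" for m
    using that
  proof (induction "\<Sum>j\<in>UNIV. Poly_Mapping.lookup m j" arbitrary: m rule: less_induct)
    case less
    show ?case
    proof
      assume mh: "(m, m) \<in> Poly_Mapping.keys h"
      \<comment> \<open>Either x^(fst a) does not divide x^m and the falling factorial is zero, or
        it is a proper divisor, whose exponent is in \<open>K\<close> by down-closure and whose
        coefficient is zero by induction.\<close>
      have other: "Poly_Mapping.lookup h a * falling m (fst a) = 0"
        if a: "a \<in> Poly_Mapping.keys h - {(m, m)}" for a
      proof (cases "\<exists>j. Poly_Mapping.lookup m j < Poly_Mapping.lookup (fst a) j")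
        case True
        then obtain j where "Poly_Mapping.lookup m j < Poly_Mapping.lookup (fst a) j" by blast
        then have "falling m (fst a) = 0" by (rule falling_eq_0)
        then show ?thesis by simp
      next
        case False
        then have le: "\<And>j. Poly_Mapping.lookup (fst a) j \<le> Poly_Mapping.lookup m j"
          by (simp add: not_less)
        have aeq: "a = (fst a, fst a)" using a h(2) by auto
        then have "fst a \<noteq> m" using a by auto
        then obtain j where "Poly_Mapping.lookup (fst a) j \<noteq> Poly_Mapping.lookup m j"
          using expo_eqI[of "fst a" m] by auto
        then have "(\<Sum>j\<in>UNIV. Poly_Mapping.lookup (fst a) j) < (\<Sum>j\<in>UNIV. Poly_Mapping.lookup m j)"
          by (intro sum_strict_mono_ex1) (use le in \<open>auto simp: le_less\<close>)
        then have "(fst a, fst a) \<notin> Poly_Mapping.keys h"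
          by (rule less.hyps) (rule K[OF less.prems le])
        then show ?thesis using a aeq by simp
      qed
      have "m \<in> M" using mh h(2) by auto
      have "(\<Sum>a\<in>Poly_Mapping.keys h - {(m, m)}. Poly_Mapping.lookup h a * falling m (fst a)) = 0"
        using other by (rule sum.neutral[rule_format])
      then have "v m = Poly_Mapping.lookup h (m, m) * falling m m"
        unfolding veq using mh by (subst sum.remove[of _ "(m, m)"]) auto
      moreover have "v m = 0" using v0 less.prems \<open>m \<in> M\<close> by simp
      ultimately show False
        using mh falling_self[of m] by (simp add: in_keys_iff)
    qed
  qed
  show ?thesis
    unfolding h(1) normal_sum_def
  proof (intro weyl.span_sum)
    fix a assume a: "a \<in> Poly_Mapping.keys h"
    then obtain m where "a = (m, m)" "m \<in> M" using h(2) by auto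
    moreover from this have "m \<notin> K" using zero a by blast
    ultimately have "multi_power weyl_x (fst a) * multi_power weyl_d (snd a) \<in> x_d_span (M - K)"
      by (intro weyl.span_base) auto
    then show "weyl_const (Poly_Mapping.lookup h a) * (multi_power weyl_x (fst a) * multi_power weyl_d (snd a))
        \<in> x_d_span (M - K)"
      unfolding weyl_scale_def[symmetric] by (rule weyl.span_scale)
  qed
qed


section \<open>Monomials vanishing in the quotient of the toric ring\<close>

lemma left_ideal_hull: "left_ideal (left_ideal hull S)"
  by (rule hull_in) (auto simp: left_ideal_def)

lemma left_ideal_diff:
  assumes "left_ideal J" "a \<in> J" "b \<in> J" shows "a - b \<in> J"
proof -
  have "(- 1) * b \<in> J" using assms unfolding left_ideal_def by blast
  then have "a + (- 1) * b \<in> J" using assms unfolding left_ideal_def by blast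
  then show ?thesis by simp
qed

text \<open>A homogeneous element whose degree is missing from N is zero there; unwinding the two
  layers of cosets turns this into membership in I_A + \<partial>_t R_A.\<close>

lemma homogeneous_notin_deg_N:
  assumes "homogeneous A u p" "u \<notin> deg_N A t"
  shows "\<exists>r. p - mvar t * r \<in> toric_ideal A"
proof -
  let ?I = "toric_ideal A"
  have I: "left_ideal ?I" unfolding toric_ideal_def by (rule left_ideal_hull)
  then have I0: "0 \<in> ?I" by (simp add: left_ideal_def)
  have "N_class A t (toric_class A p) = N_class A t (toric_class A 0)"
    using assms by (auto simp: deg_N_def N_component_def)
  \<comment> \<open>The zero class is probed with its member coming from the multiple 0; finding it
    in the class of \<open>p\<close> yields \<open>r\<close>.\<close>
  moreover have "toric_class A 0 + toric_class A (mvar t * 0) \<in> N_class A t (toric_class A 0)"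
    unfolding N_class_def toric_multiples_def by (rule set_plus_intro2) blast
  ultimately have "toric_class A 0 + toric_class A (mvar t * 0) \<in> N_class A t (toric_class A p)"
    by simp
  then obtain r where r: "toric_class A 0 + toric_class A (mvar t * 0)
      = toric_class A p + toric_class A (mvar t * r)"
    unfolding N_class_def toric_multiples_def elt_set_plus_def by blast
  have "p + 0 + (mvar t * r + 0) \<in> toric_class A p + toric_class A (mvar t * r)"
    unfolding toric_class_def by (intro set_plus_intro set_plus_intro2 I0)
  then have "p + mvar t * r \<in> toric_class A 0 + toric_class A (mvar t * 0)"
    using r by simp
  then have "p + mvar t * r \<in> ?I"
    using I by (auto simp: toric_class_def elt_set_plus_def set_plus_def left_ideal_def)
  \<comment> \<open>The cosets gave \<open>p + mvar t * r\<close>, hence the sign of the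
    witness.\<close>
  then show ?thesis by (intro exI[of _ "- r"]) simp
qed

section \<open>Operators with constant coefficients inside the Weyl algebra\<close>

lemma weyl_of_R_superset:
  assumes "finite S" "Poly_Mapping.keys p \<subseteq> S"
  shows "weyl_of_R p = (\<Sum>m\<in>S. weyl_scale (Poly_Mapping.lookup p m) (multi_power weyl_d m))"
  unfolding weyl_of_R_def
  by (rule sum.mono_neutral_left) (use assms in \<open>auto simp: in_keys_iff\<close>)

lemma weyl_of_R_add: "weyl_of_R (p + q) = weyl_of_R p + weyl_of_R q"
proof -
  let ?S = "Poly_Mapping.keys p \<union> Poly_Mapping.keys q"
  have "Poly_Mapping.keys (p + q) \<subseteq> ?S" by (rule Poly_Mapping.keys_add)
  then show ?thesis
    by (simp add: weyl_of_R_superset[of ?S] lookup_add weyl.scale_left_distrib sum.distrib)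
qed

lemma weyl_of_R_zero [simp]: "weyl_of_R 0 = 0"
  by (simp add: weyl_of_R_def)

lemma weyl_of_R_single: "weyl_of_R (Poly_Mapping.single m c) = weyl_scale c (multi_power weyl_d m)"
  by (subst weyl_of_R_superset[of "{m}"]) auto

text \<open>As m_t = 0, the factor x^m does not lower the V-degree along y_t, while \<partial>_t
  becomes y_t and raises it to at least 1.\<close>

lemma fourier_inv_x_power_mult_weyl_of_R:
  assumes "Poly_Mapping.lookup m t = 0"
  shows "fourier_inv (multi_power weyl_x m * weyl_of_R (mvar t * r)) \<in> V_filtration t 1"
proof (induction r rule: finsupp_induct)
  case zero
  show ?case by (simp add: V_filtration_def weyl.span_zero)
next
  case (single k c)
  let ?k = "Poly_Mapping.single t 1 + k"
  have "fourier_inv (multi_power weyl_x m * multi_power weyl_d ?k) \<in> V_filtration t 1"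
    by (rule fourier_inv_monomial_in_V_filtration) (simp add: assms lookup_add)
  then have "weyl_scale c (fourier_inv (multi_power weyl_x m * multi_power weyl_d ?k)) \<in> V_filtration t 1"
    unfolding V_filtration_def by (rule weyl.span_scale)
  then show ?case
    by (simp add: mvar_def mult_single weyl_of_R_single weyl_scale_def weyl_const_left
        fourier_inv_mult[of "weyl_const c"] fourier_inv_const)
next
  case (add p q)
  then show ?case
    by (simp add: distrib_left weyl_of_R_add fourier_inv_add V_filtration_def weyl.span_add)
qed

text \<open>Splits x^m \<partial>^m as x^m (\<partial>^m - \<partial>_t r) + x^m \<partial>_t r: the
  first summand is in the hypergeometric ideal, the second has its Fourier transform in V^1.\<close>

lemma fourier_inv_x_d_power_in_hypergeometric:
  assumes m: "Poly_Mapping.lookup m t = 0"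
    and r: "Poly_Mapping.single m 1 - mvar t * r \<in> toric_ideal A"
  shows "fourier_inv (multi_power weyl_x m * multi_power weyl_d m) \<in>
    fourier_inv ` hypergeometric_ideal A \<beta> + V_filtration t 1"
proof -
  let ?H = "hypergeometric_ideal A \<beta>"
  have "weyl_of_R (Poly_Mapping.single m 1 - mvar t * r) \<in> ?H"
    unfolding hypergeometric_ideal_def by (rule hull_inc) (use r in blast)
  then have "multi_power weyl_x m * weyl_of_R (Poly_Mapping.single m 1 - mvar t * r) \<in> ?H"
    using left_ideal_hull unfolding hypergeometric_ideal_def left_ideal_def by blast
  then have "fourier_inv (multi_power weyl_x m * weyl_of_R (Poly_Mapping.single m 1 - mvar t * r))
     + fourier_inv (multi_power weyl_x m * weyl_of_R (mvar t * r)) \<in> fourier_inv ` ?H + V_filtration t 1"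
    by (intro set_plus_intro imageI fourier_inv_x_power_mult_weyl_of_R m)
  moreover have "multi_power weyl_x m * weyl_of_R (Poly_Mapping.single m 1 - mvar t * r)
     + multi_power weyl_x m * weyl_of_R (mvar t * r) = multi_power weyl_x m * multi_power weyl_d m"
    by (simp add: weyl_of_R_single weyl_scale_def flip: distrib_left weyl_of_R_add)
  ultimately show ?thesis by (simp add: fourier_inv_add[symmetric])
qed

lemma fourier_inv_x_d_span_in_hypergeometric:
  assumes M: "\<And>m. m \<in> M \<Longrightarrow> Poly_Mapping.lookup m t = 0 \<and>
      (\<exists>r. Poly_Mapping.single m 1 - mvar t * r \<in> toric_ideal A)"
    and P: "P \<in> x_d_span M"
  shows "fourier_inv P \<in> fourier_inv ` hypergeometric_ideal A \<beta> + V_filtration t 1"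
  using P
proof (induction rule: weyl.span_induct_alt)
  let ?J = "fourier_inv ` hypergeometric_ideal A \<beta>"
  have J: "left_ideal ?J"
    unfolding hypergeometric_ideal_def by (intro left_ideal_fourier_inv_image left_ideal_hull)
  {
    case base
    have "0 + 0 \<in> ?J + V_filtration t 1"
      by (rule set_plus_intro) (use J in \<open>auto simp: left_ideal_def V_filtration_def weyl.span_zero\<close>)
    then show ?case by simp
  next
    case (step c P Q)
    then have "fourier_inv P \<in> ?J + V_filtration t 1"
      using M fourier_inv_x_d_power_in_hypergeometric by blast
    then show ?case
      by (simp add: fourier_inv_add weyl_scale_def fourier_inv_mult[of "weyl_const c"] fourier_inv_const)
        (intro left_ideal_add_V_filtration_add left_ideal_add_V_filtration_scale J step(2))
  }
qed


section \<open>Polynomials vanishing on the degrees\<close>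

text \<open>The part of an Euler operator without \<theta>_t; modulo the hypergeometric ideal it
  equals \<beta>_i - a_(i,t) \<theta>_t.\<close>

definition reduced_euler :: "int ^ 'n::finite ^ 'd::finite \<Rightarrow> 'n \<Rightarrow> 'd \<Rightarrow> 'n weyl" where
  "reduced_euler A t i = (\<Sum>j\<in>UNIV - {t}. weyl_const (of_int (A $ i $ j)) * (weyl_x j * weyl_d j))"

text \<open>The eigenvalues of the reduced Euler operators on x^k, hence complex; they agree with
  the degree of \<partial>^k when k_t = 0.\<close>

definition reduced_degree :: "int ^ 'n::finite ^ 'd::finite \<Rightarrow> 'n \<Rightarrow> 'n expo \<Rightarrow> complex ^ 'd" where
  "reduced_degree A t k = (\<chi> i. \<Sum>j\<in>UNIV - {t}. of_int (A $ i $ j) * of_nat (Poly_Mapping.lookup k j))"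

lemma reduced_degree_eq_cvec:
  assumes "Poly_Mapping.lookup k t = 0"
  shows "reduced_degree A t k = cvec (expo_deg A k)"
proof -
  have "(\<Sum>j\<in>UNIV - {t}. of_int (A $ i $ j) * of_nat (Poly_Mapping.lookup k j)) =
     (\<Sum>j\<in>UNIV. of_int (A $ i $ j) * of_nat (Poly_Mapping.lookup k j) :: complex)" for i
    by (rule sum.mono_neutral_left) (use assms in auto)
  then show ?thesis
    by (simp add: reduced_degree_def cvec_def expo_deg_def column_def vec_eq_iff mult.commute)
qed

lemma euler_op_eq:
  fixes A :: "int ^ 'n::finite ^ 'd::finite"
  shows "euler_op A i = weyl_const (of_int (A $ i $ t)) * (weyl_x t * weyl_d t) + reduced_euler A t i"
proof -
  have "of_int a = (weyl_const (of_int a) :: 'n weyl)" for a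
    by (cases a rule: int_cases2) (simp_all add: weyl_const_uminus weyl_const_of_nat)
  then have "euler_op A i = (\<Sum>j\<in>UNIV. weyl_const (of_int (A $ i $ j)) * (weyl_x j * weyl_d j))"
    by (simp add: euler_op_def mult.assoc)
  then show ?thesis
    by (simp add: reduced_euler_def sum.remove[of UNIV t])
qed

lemma has_eigenvalues_reduced_euler:
  "has_eigenvalues (reduced_euler A t i) (\<lambda>k. reduced_degree A t k $ i)"
  unfolding reduced_euler_def reduced_degree_def
  by simp (intro has_eigenvalues_sum has_eigenvalues_mult has_eigenvalues_const has_eigenvalues_theta)

text \<open>Only \<theta>_j with j \<noteq> t occur, so the exponent m_t stays 0.\<close>

lemma reduced_euler_mult_x_d_span:
  assumes "P \<in> x_d_span {m. Poly_Mapping.lookup m t = 0}"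
  shows "reduced_euler A t i * P \<in> x_d_span {m. Poly_Mapping.lookup m t = 0}"
  unfolding reduced_euler_def sum_distrib_right
proof (intro weyl.span_sum)
  fix j assume "j \<in> UNIV - {t}"
  then have "weyl_x j * weyl_d j * P \<in> x_d_span {m. Poly_Mapping.lookup m t = 0}"
    by (intro theta_mult_x_d_span assms) (auto simp: lookup_add lookup_single)
  then have "weyl_scale (of_int (A $ i $ j)) (weyl_x j * weyl_d j * P) \<in>
      x_d_span {m. Poly_Mapping.lookup m t = 0}"
    by (rule weyl.span_scale)
  then show "weyl_const (of_int (A $ i $ j)) * (weyl_x j * weyl_d j) * P \<in>
      x_d_span {m. Poly_Mapping.lookup m t = 0}"
    by (simp add: weyl_scale_def mult.assoc)
qed

text \<open>Here \<open>q(\<theta>\<^sub>t)\<close> is \<open>f(\<beta> - \<theta>\<^sub>t a\<^sub>t)\<close> and \<open>P\<close> is \<open>f\<close> at the sum of the \<open>\<theta>\<^sub>j a\<^sub>j\<close> with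
  \<open>j \<noteq> t\<close>.\<close>

lemma eval_on_line:
  fixes A :: "int ^ 'n::finite ^ 'd::finite" and \<beta> :: "complex ^ 'd" and f :: "'d mpoly"
  shows "\<exists>q P. (\<forall>s. poly q s = mpoly_eval f (\<beta> - s *s cvec (column t A))) \<and>
    weyl_eval q (weyl_x t * weyl_d t) - P \<in> hypergeometric_ideal A \<beta> \<and>
    P \<in> x_d_span {m. Poly_Mapping.lookup m t = 0} \<and>
    has_eigenvalues P (\<lambda>k. mpoly_eval f (reduced_degree A t k))"
    (is "\<exists>q P. ?good f q P")
proof -
  let ?H = "hypergeometric_ideal A \<beta>"
  have H: "left_ideal ?H" unfolding hypergeometric_ideal_def by (rule left_ideal_hull)
  have euler: "euler_op A i - weyl_const (\<beta> $ i) \<in> ?H" for i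
    unfolding hypergeometric_ideal_def by (rule hull_inc) blast
  have good_zero: "?good 0 0 0"
    using H by (auto simp: weyl.span_zero has_eigenvalues_zero left_ideal_def)
  have good_add: "?good (f + g) (p + q) (P + Q)" if "?good f p P" "?good g q Q" for f g p q P Q
  proof -
    have "weyl_eval (p + q) (weyl_x t * weyl_d t) - (P + Q) =
      (weyl_eval p (weyl_x t * weyl_d t) - P) + (weyl_eval q (weyl_x t * weyl_d t) - Q)"
      by (simp add: weyl_eval_add)
    then have "weyl_eval (p + q) (weyl_x t * weyl_d t) - (P + Q) \<in> ?H"
      using that H unfolding left_ideal_def by metis
    then show ?thesis
      using that by (simp add: mpoly_eval_add weyl.span_add has_eigenvalues_add)
  qed
  have good_const: "?good (Poly_Mapping.single 0 c) [:c:] (weyl_const c)" for c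
  proof -
    have "weyl_scale c (multi_power weyl_x 0 * multi_power weyl_d 0) \<in>
        x_d_span {m :: 'n expo. Poly_Mapping.lookup m t = 0}"
      by (intro weyl.span_scale weyl.span_base) (rule CollectI, rule exI[of _ 0], simp)
    moreover have "weyl_scale c (multi_power weyl_x 0 * multi_power weyl_d 0) = (weyl_const c :: 'n weyl)"
      by (simp add: weyl_scale_def)
    ultimately have "weyl_const c \<in> x_d_span {m :: 'n expo. Poly_Mapping.lookup m t = 0}"
      by simp
    then show ?thesis
      using H has_eigenvalues_const[of c]
      by (simp add: mpoly_eval_single weyl_eval_pCons left_ideal_def)
  qed
  \<comment> \<open>The linear factor is coordinate \<open>i\<close> of \<beta> - s a_t; its
    counterpart among the operators is \<open>reduced_euler A t i\<close>.\<close>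
  have good_step: "?good (Poly_Mapping.single (Poly_Mapping.single i 1 + m) c)
      ([:\<beta> $ i, - of_int (A $ i $ t):] * q) (reduced_euler A t i * P)"
    if g: "?good (Poly_Mapping.single m c) q P" for i m c q P
  proof -
    let ?T = "weyl_x t * weyl_d t"
    let ?L = "weyl_eval [:\<beta> $ i, - of_int (A $ i $ t):] ?T"
    have L: "?L - reduced_euler A t i = - (euler_op A i - weyl_const (\<beta> $ i))"
      by (simp add: weyl_eval_pCons euler_op_eq[of A i t] weyl_const_uminus weyl_const_central)
    have P: "has_eigenvalues P (\<lambda>k. mpoly_eval (Poly_Mapping.single m c) (reduced_degree A t k))"
      using g by blast
    \<comment> \<open>The Euler generator has to stand to the right of \<open>P\<close> to be
      absorbed by the left ideal; both are diagonal, so they commute.\<close>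
    have "euler_op A i * P = P * euler_op A i"
      unfolding euler_op_eq[of A i t]
      by (rule has_eigenvalues_commute[OF has_eigenvalues_add[OF has_eigenvalues_mult[OF
          has_eigenvalues_const has_eigenvalues_theta] has_eigenvalues_reduced_euler] P])
    then have com: "(euler_op A i - weyl_const (\<beta> $ i)) * P = P * (euler_op A i - weyl_const (\<beta> $ i))"
      by (simp add: left_diff_distrib right_diff_distrib weyl_const_central)
    \<comment> \<open>Telescoping: the first summand is a left multiple of the inductive difference,
      the second contains the Euler generator.\<close>
    have "weyl_eval ([:\<beta> $ i, - of_int (A $ i $ t):] * q) ?T - reduced_euler A t i * P =
        ?L * (weyl_eval q ?T - P) + (?L - reduced_euler A t i) * P"
      by (simp only: weyl_eval_mult) (simp only: left_diff_distrib right_diff_distrib, simp)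
    also have "\<dots> = ?L * (weyl_eval q ?T - P) - P * (euler_op A i - weyl_const (\<beta> $ i))"
      unfolding L minus_mult_left[symmetric] com by (rule add_uminus_conv_diff)
    also have "\<dots> \<in> ?H"
      by (rule left_ideal_diff[OF H]) (use g H euler in \<open>auto simp: left_ideal_def\<close>)
    finally have H': "weyl_eval ([:\<beta> $ i, - of_int (A $ i $ t):] * q) ?T - reduced_euler A t i * P \<in> ?H" .
    have "poly ([:\<beta> $ i, - of_int (A $ i $ t):] * q) s =
      mpoly_eval (Poly_Mapping.single (Poly_Mapping.single i 1 + m) c) (\<beta> - s *s cvec (column t A))" for s
    proof -
      have "poly q s = mpoly_eval (Poly_Mapping.single m c) (\<beta> - s *s cvec (column t A))"
        using g by blast
      then show ?thesis
        by (simp add: mpoly_eval_single_step cvec_def column_def left_diff_distrib mult.assoc)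
    qed
    moreover have "has_eigenvalues (reduced_euler A t i * P)
        (\<lambda>k. mpoly_eval (Poly_Mapping.single (Poly_Mapping.single i 1 + m) c) (reduced_degree A t k))"
      unfolding mpoly_eval_single_step by (rule has_eigenvalues_mult[OF has_eigenvalues_reduced_euler P])
    moreover have "reduced_euler A t i * P \<in> x_d_span {m. Poly_Mapping.lookup m t = 0}"
      using g by (intro reduced_euler_mult_x_d_span) blast
    ultimately show ?thesis using H' by blast
  qed
  show ?thesis
  proof (induction f rule: finsupp_induct)
    case zero
    then show ?case using good_zero by blast
  next
    case (single m c)
    show ?case
    proof (induction m rule: expo_induct)
      case zero
      show ?case using good_const by blast
    next
      case (step i m)
      then obtain q P where "?good (Poly_Mapping.single m c) q P" by (elim exE)
      from good_step[OF this, of i]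
      show ?case by (intro exI)
    qed
  next
    case (add f g)
    then obtain p P q Q where "?good f p P" "?good g q Q" by (elim exE)
    from good_add[OF this]
    show ?case by (intro exI)
  qed
qed

lemma eval_on_line_in_hypergeometric:
  fixes A :: "int ^ 'n::finite ^ 'd::finite" and \<beta> :: "complex ^ 'd" and f :: "'d mpoly"
  assumes f: "\<And>u. u \<in> deg_N A t \<Longrightarrow> mpoly_eval f (cvec u) = 0"
  obtains q where "\<And>s. poly q s = mpoly_eval f (\<beta> - s *s cvec (column t A))"
    and "weyl_eval q (- weyl_d t * weyl_x t) \<in>
      fourier_inv ` hypergeometric_ideal A \<beta> + V_filtration t 1"
proof -
  let ?T = "weyl_x t * weyl_d t :: 'n weyl"
  let ?J = "fourier_inv ` hypergeometric_ideal A \<beta>"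
  let ?M = "{m :: 'n expo. Poly_Mapping.lookup m t = 0}"
  \<comment> \<open>\<open>B\<close> collects the exponents of monomials that are zero in N. It is
    closed under multiples, so its complement is down-closed, as \<open>x_d_span_vanishing\<close>
    requires of \<open>K\<close>.\<close>
  define B :: "'n expo set" where
    "B = {m. \<exists>r. Poly_Mapping.single m 1 - mvar t * r \<in> toric_ideal A}"
  have I: "left_ideal (toric_ideal A)" unfolding toric_ideal_def by (rule left_ideal_hull)
  have J: "left_ideal ?J"
    unfolding hypergeometric_ideal_def by (intro left_ideal_fourier_inv_image left_ideal_hull)
  obtain q P where q: "\<And>s. poly q s = mpoly_eval f (\<beta> - s *s cvec (column t A))"
    and qP: "weyl_eval q ?T - P \<in> hypergeometric_ideal A \<beta>"
    and P: "P \<in> x_d_span ?M"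
    and v: "has_eigenvalues P (\<lambda>k. mpoly_eval f (reduced_degree A t k))"
    using eval_on_line[of f \<beta> t A] by blast
  have "P \<in> x_d_span (?M - - B)"
  proof (rule x_d_span_vanishing[OF P v])
    fix k m :: "'n expo"
    assume m: "m \<in> - B" and le: "\<And>j. Poly_Mapping.lookup k j \<le> Poly_Mapping.lookup m j"
    show "k \<in> - B"
    proof
      assume "k \<in> B"
      then obtain r where r: "Poly_Mapping.single k 1 - mvar t * r \<in> toric_ideal A"
        by (auto simp: B_def)
      have "m - k + k = m"
        by (intro expo_eqI) (simp add: lookup_add lookup_minus le)
      then have "Poly_Mapping.single m 1 - mvar t * (Poly_Mapping.single (m - k) 1 * r) =
         Poly_Mapping.single (m - k) 1 * (Poly_Mapping.single k 1 - mvar t * r)"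
        by (simp add: right_diff_distrib mult_single mult.left_commute)
      also have "\<dots> \<in> toric_ideal A" using r I by (simp add: left_ideal_def)
      finally show False using m by (auto simp: B_def)
    qed
  next
    fix m :: "'n expo"
    assume m: "m \<in> - B" "m \<in> ?M"
    \<comment> \<open>By contraposition: \<partial>^m is nonzero in N, so \<open>f\<close> vanishes
      at its degree.\<close>
    have "expo_deg A m \<in> deg_N A t"
      using homogeneous_notin_deg_N[of A "expo_deg A m" "Poly_Mapping.single m 1" t] m(1)
      by (auto simp: B_def homogeneous_def)
    then show "mpoly_eval f (reduced_degree A t m) = 0"
      using f m(2) by (simp add: reduced_degree_eq_cvec)
  qed
  then have P': "fourier_inv P \<in> ?J + V_filtration t 1"
    by (rule fourier_inv_x_d_span_in_hypergeometric[rotated]) (auto simp: B_def)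
  have "fourier_inv (weyl_eval q ?T - P) + 0 \<in> ?J + V_filtration t 1"
    by (intro set_plus_intro imageI qP) (simp add: V_filtration_def weyl.span_zero)
  then have "fourier_inv (weyl_eval q ?T - P) + 0 + fourier_inv P \<in> ?J + V_filtration t 1"
    using P' by (rule left_ideal_add_V_filtration_add[OF J])
  \<comment> \<open>The Fourier transform takes x_t \<partial>_t to -\<delta>_t y_t, the argument of
    the b-function.\<close>
  moreover have "fourier_inv (weyl_eval q ?T - P) + 0 + fourier_inv P
      = weyl_eval q (- weyl_d t * weyl_x t)"
    by (simp add: fourier_inv_weyl_eval fourier_inv_mult fourier_inv_x fourier_inv_d
        flip: fourier_inv_add)
  ultimately have "weyl_eval q (- weyl_d t * weyl_x t) \<in> ?J + V_filtration t 1"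
    by (simp only:)
  then show thesis by (rule that[OF q])
qed

end

section \<open>Roots of the b-function and quasi-degrees\<close>

theorem theorem2p5:
  fixes A :: "int ^ 'n::finite ^ 'd::finite" and \<beta> :: "complex ^ 'd" and t :: 'n
    and b :: "complex poly" and \<epsilon> :: complex
  assumes "CARD('d) \<le> CARD('n)"
    and "range (\<lambda>v :: int ^ 'n. A *v v) = UNIV"
    and "is_b_function (fourier_inv ` hypergeometric_ideal A \<beta>) t b"
    and "poly b \<epsilon> = 0"
  shows "\<epsilon> *s cvec (column t A) \<in>
    range (\<lambda>c. c *s cvec (column t A)) \<inter> {\<beta> - q | q. q \<in> qdeg_N A t}"
proof -
  let ?a = "cvec (column t A)"
  have J: "left_ideal (fourier_inv ` hypergeometric_ideal A \<beta>)"
    unfolding hypergeometric_ideal_def by (intro left_ideal_fourier_inv_image left_ideal_hull)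
  have "\<beta> - \<epsilon> *s ?a \<in> qdeg_N A t"
    unfolding qdeg_N_def zariski_closure_def hull_def
  proof (intro InterI, clarsimp simp: zariski_closed_def)
    \<comment> \<open>The closure is the intersection of all zero sets containing the degrees, so it
      suffices that each \<open>f\<close> of a defining family \<open>F\<close> vanishes at the
      point.\<close>
    fix F f
    assume F: "cvec ` deg_N A t \<subseteq> {z. \<forall>f\<in>F. mpoly_eval f z = 0}" and f: "f \<in> F"
    obtain q where q: "\<And>s. poly q s = mpoly_eval f (\<beta> - s *s ?a)"
      and qJ: "weyl_eval q (- weyl_d t * weyl_x t) \<in>
        fourier_inv ` hypergeometric_ideal A \<beta> + V_filtration t 1"
      by (rule eval_on_line_in_hypergeometric[of A t f \<beta>]) (use F f in auto)
    have "b dvd q" by (rule is_b_function_dvd[OF assms(3) J qJ])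
    then have "poly q \<epsilon> = 0" using assms(4) by (auto elim: dvdE)
    then show "mpoly_eval f (\<beta> - \<epsilon> *s ?a) = 0" by (simp add: q)
  qed
  moreover have "\<epsilon> *s ?a = \<beta> - (\<beta> - \<epsilon> *s ?a)" by simp
  ultimately show ?thesis by blast
qed

end
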